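(* Let $G$ be the classical vertex group (so $H=\mathbb{C}[T]$, $D^{(1)}=T$, $K=\mathbb{C}[[x]][x^{-1}]$), and let $(B,\{f_p\})$ be a commutative algebra in the relaxed multilinear category of representations of $G$. Then $(B,\{f_p\})$ gives rise to a vertex algebra with state space $B$, vacuum vector $|0\rangle=f_{\circ}(1)$ (where $\circ$ is the empty tree), infinitesimal translation operator $T=D^{(1)}:B\to B$, and vertex operator $$Y(\cdot,x)\cdot \;=\; f_2(\cdot\otimes\cdot)\big|_{y=0}:B\otimes B\longrightarrow B[[x]][x^{-1}],$$ where $f_2$ is the map of the algebra associated to the flat tree with two leaves, regarded as a map $B\otimes B\to B[[x,y]][(x-y)^{-1}]$.
   Context: **Vertex algebra.** A complex vector space $V$ with an endomorphism $T$, a vector $|0\rangle\in V$, and a linear map $Y(\cdot,x)\cdot:V\otimes V\to V[[x]][x^{-1}]$ such that: (vacuum) $T|0\rangle=0$, $Y(|0\rangle,x)a=a$, $Y(a,x)|0\rangle$ has no negative powers of $x$ and $Y(a,x)|0\rangle|_{x=0}=a$ for all $a$; (translation covariance) $[T,Y(a,x)]=\partial_xY(a,x)$; (locality) for all $a,b\in V$ there is $N\gg0$ with $(x-y)^N[Y(a,x),Y(b,y)]=0$. **Notation.** $B[[x]]$ is power series with coefficients in $B$; $B[[x]][x^{-1}]$ is Laurent series; notations are iterated from left to right. **Classical vertex group $G$.** $H=\mathbb{C}[T]$, $D^{(i)}=T^i/i!$, $\Delta(D^{(i)})=\sum_{p+q=i}D^{(p)}\otimes D^{(q)}$, $\epsilon(D^{(i)})=\delta_{i,0}$,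 $S(D^{(i)})=(-1)^iD^{(i)}$; $H^*=\mathbb{C}[[x]]$; $K=\mathbb{C}[[x]][x^{-1}]$ with $D^{(j)}\cdot x^i=\binom{i}{j}x^{i-j}$, $S(x^i)=(-1)^ix^i$. A $G$-module (representation of $G$) is an $H$-module, and $H$ acts on tensor products through $\Delta$. For an $H$-module $N$, $\mathrm{Hom}_{\mathbb C}(H^{\otimes n},N)=N[[x_1,\dots,x_n]]$ (coefficient of $x_1^{i_1}\cdots x_n^{i_n}$ = value at $D^{(i_1)}\otimes\cdots\otimes D^{(i_n)}$); $T$ acting in the $i$-th slot of $H^{\otimes n}$ acts as $\partial_{x_i}$. "Tensoring with $K$ over $f_{i,j}$" means adjoining $(x_i-x_j)^{-1}$. An element of $N[[x_1,\dots,x_n]]$ or its localisations is $G$-invariant if $T_N=\partial_{x_1}+\cdots+\partial_{x_n}$ on it. **Trees.** A tree is a finite connected oriented planar graph without circuits, with a chosen root; leaves are the non-root vertices joined to exactly one edge; all other vertices are internal (the root included). $\circ$ is the empty tree (0 leaves); $\bullet$ is the tree with a single vertex and no edges, regarded as having one leaf and no internal vertices. A flat tree is one of height 1. $p$ is a refinement of $q$ if it is obtained from $q$ by finitely many moves: shrinking to a vertex an internal edge (one not ending in a leaf), or replacing a vertex by an edge. **Singular multilinear maps.** Let $p$ have $n\ge1$ leaves, labelled by $G$-modules $A_1,\dots,A_n$; let $B$ be a $G$-module. Each edge $e$ carries a variable $x_e$. Let $q$ be an internal vertex with incoming edges $e_1,\dots,e_r$ (edges to vertices one level higher). Put $X_{q,i}=A_j$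 if $e_i$ ends in the $j$-th leaf, and $X_{q,i}=H^{\otimes r'}$ if $e_i$ ends in an internal vertex $q'$ with $r'$ incoming edges (maps out of this $H^{\otimes r'}$ are power series in the variables of the edges incoming to $q'$); $X_q=X_{q,1}\otimes\cdots\otimes X_{q,r}$. For $\sigma$ in the alternating group $A_r$ and $M$ a module over $\mathbb{C}[[x_{e_1},\dots,x_{e_r}]]$ with $H^{\otimes r}$-action by the $\partial_{x_{e_i}}$, let $\mathrm{Sing}_{\sigma,q}(M)$ be $$\mathrm{Hom}\Bigl(X_{q,\sigma(1)}\otimes X_{q,\sigma(2)},K\otimes\mathrm{Hom}\bigl(X_{q,\sigma(3)},K^{\otimes2}\otimes(\cdots\mathrm{Hom}(X_{q,\sigma(r)},K^{\otimes r-1}\otimes M)\cdots)\bigr)\Bigr),$$ where the $K$'s at the stage where $X_{q,\sigma(k)}$ is introduced adjoin the $(x_{e_{\sigma(i)}}-x_{e_{\sigma(k)}})^{-1}$, $i<k$ (so the order of that pole depends only on the inputs introduced up to that stage), and where only $H^{\otimes r}$-linear maps are taken: $T$ acting on $X_{q,i}$ (on $A_j$, or diagonally on $H^{\otimes r'}$) corresponds to $\partial_{x_{e_i}}$. $\mathrm{Sing}_q(M)$ is the pullback of the $\mathrm{Sing}_{\sigma,q}(M)$, $\sigma\in A_r$, over $\mathrm{Hom}(X_q,K^{\otimes\binom r2}\otimes M)$; for $r=1$ it is $\mathrm{Hom}_H(X_q,M)$. For a total order $t$: $\mathrm{root}<p_1<\dots<p_l$ of the internal vertices extending the tree order (root least),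 $\mathrm{Ord}_t=\mathrm{Sing}_{p_l}\cdots\mathrm{Sing}_{p_1}\mathrm{Sing}_{\mathrm{root}}\,B[[x_e: e\text{ incoming at the root}]]$. $\mathrm{Multi}^K_p(A_1,\dots,A_n;B)$ is the wide pullback of all $\mathrm{Ord}_t$ over $\mathrm{Hom}_{H^{\otimes n}}(A_1\otimes\cdots\otimes A_n,\mathrm{Fun}_p(H^{\otimes n},B))$. Here $\mathrm{Fun}_p$ is defined by recursion on height: for $p$ flat it is $B[[x_1,\dots,x_n]][(x_i-x_j)^{-1}]_{i<j}$; otherwise, let $q$ (with $m$ leaves) be obtained from $p$ by deleting the top-level edges, let the $l$-th factor of $H^{\otimes m}$ act diagonally on the factors of $H^{\otimes n}$ corresponding to the leaves of $p$ lying over leaf $l$ of $q$, and let $\mathrm{Fun}_p$ be $\mathrm{Hom}_{H^{\otimes m}}(H^{\otimes n},\mathrm{Fun}_q(H^{\otimes m},B))$ localised at all pairs of factors lying over the same leaf of $q$. $\mathrm{Multi}^K_{G,p}$ (the $G$-invariant maps) is obtained by replacing $B[[x_e]]$ by its $G$-invariant elements. For example, $\mathrm{Multi}^K_{G,p}$ for the flat 2-leafed tree consists of linear $f:A_1\otimes A_2\to B[[x,y]][(x-y)^{-1}]$ with $f(Ta\otimes b)=\partial_xf(a\otimes b)$, $f(a\otimes Tb)=\partial_yf(a\otimes b)$, $T_Bf=(\partial_x+\partial_y)f$. Also $\mathrm{Multi}^K_\bullet(A;B)=\mathrm{Hom}(A,B)$ (invariant: $\mathrm{Hom}_H(A,B)$)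 and $\mathrm{Multi}^K_\circ(\mathbb{C};B)=\mathrm{Hom}(\mathbb C,B)\cong B$ (invariant: vectors killed by $T$). **Composition** of $G$-invariant maps is pointwise: the lower map is extended coefficientwise to the series produced by the upper maps; the result has as its tree the one obtained by gluing roots to leaves, where gluing $\circ$ at a leaf removes that leaf. **Refinement maps.** If $p$ is a refinement of $q$ there is a canonical map $r_{p,q}:\mathrm{Multi}^K_{G,p}\to\mathrm{Multi}^K_{G,q}$. If $p$ arises by shrinking an internal edge with variable $y$ below a vertex with incoming variables $z_1,\dots,z_m$, it substitutes $w_i\mapsto z_i+y$ for the variables $w_i$ of the corresponding edges in $p$, leaves the other variables unchanged, sends $(w_i-w_j)^{-1}\mapsto(z_i-z_j)^{-1}$, and expands $(z_i+y-w)^{-1}$, $w$ the variable of another edge at the lower vertex, in non-negative powers of $z_i$. If $p$ arises by replacing a vertex by an edge, it is the analogous canonical isomorphism; in particular, for $p=\bullet$ and $q$ the flat one-leafed tree it sends $f$ to $b\mapsto e^{Tx}f(b)$. **Algebra in this relaxed multilinear category.** A $G$-module $B$ with maps $f_p\in\mathrm{Multi}^K_{G,p}(B,\dots,B;B)$, one for each $n$-leafed tree $p$, $n\in\mathbb N$, such that: (composition) $f_{q(p_1,\dots,p_n)}=f_q\circ(f_{p_1},\dots,f_{p_n})$, where $q(p_1,\dots,p_n)$ is formed by gluing the root of $p_i$ to the $i$-th external edge of $q$ ($p_i$ possibly empty); (unit) $f_\circ:\mathbb C\to B$ satisfies $f_p\circ_kf_\circ=f_{p'}$, with $p'$ obtained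 from $p$ by removing the $k$-th leaf; (refinement) $r_{p,q}(f_p)=f_q$ whenever $p$ refines $q$. $f_\bullet=1_B$. $f_n$ denotes $f_p$ for $p$ the flat tree with $n$ leaves ($f_0=f_\circ$). The algebra is commutative if there is an action of the symmetric group on each of the maps in $\{f_p\}$, i.e. they are symmetric under simultaneous permutation of inputs and of the corresponding variables (in particular each $f_n$ is). *)

theory Defs
  imports
    "HOL-Computational_Algebra.Formal_Laurent_Series"
    "HOL-Combinatorics.Permutations"
    "HOL-Library.Sublist"
begin

section \<open>Vertex algebras\<close>

locale G_module = vector_space scale
  for scale :: "complex \<Rightarrow> 'b::ab_group_add \<Rightarrow> 'b" (infixr "*s" 75) +
  fixes T :: "'b \<Rightarrow> 'b"
  assumes linear_T: "Vector_Spaces.linear scale scale T"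

text \<open>
  A linear map \<open>V \<otimes> V \<rightarrow> V[[x]][x\<^sup>-\<^sup>1]\<close> is a bilinear map into formal Laurent series.
  In the locality axiom a formal distribution in \<open>x, y\<close> is the function sending \<open>m, n\<close> to
  its coefficient at \<open>x\<^sup>m y\<^sup>n\<close>; the number \<open>N\<close> does not depend on the vector \<open>c\<close> to which
  the commutator is applied.
\<close>

definition mult_x_minus_y :: "(int \<Rightarrow> int \<Rightarrow> 'b::ab_group_add) \<Rightarrow> int \<Rightarrow> int \<Rightarrow> 'b" where
  "mult_x_minus_y F = (\<lambda>m n. F (m - 1) n - F m (n - 1))"

locale vertex_algebra = G_module scale T
  for scale :: "complex \<Rightarrow> 'b::ab_group_add \<Rightarrow> 'b" (infixr "*s" 75) and T :: "'b \<Rightarrow> 'b" +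
  fixes vac :: 'b and Y :: "'b \<Rightarrow> 'b \<Rightarrow> 'b fls"
  assumes Y_linear_left: "Vector_Spaces.linear scale scale (\<lambda>a. fls_nth (Y a b) n)"
    and Y_linear_right: "Vector_Spaces.linear scale scale (\<lambda>b. fls_nth (Y a b) n)"
    and T_vac: "T vac = 0"
    and Y_vac: "Y vac a = fls_const a"
    and Y_vac_regular: "n < 0 \<Longrightarrow> fls_nth (Y a vac) n = 0"
    and Y_vac_creation: "fls_nth (Y a vac) 0 = a"
    and translation_covariance:
      "T (fls_nth (Y a b) n) - fls_nth (Y a (T b)) n = of_int (n + 1) *s fls_nth (Y a b) (n + 1)"
    and locality: "\<exists>N. \<forall>c. (mult_x_minus_y ^^ N)
        (\<lambda>m n. fls_nth (Y a (fls_nth (Y b c) n)) m - fls_nth (Y b (fls_nth (Y a c) m)) n)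
        = (\<lambda>m n. 0)"


section \<open>Trees\<close>

text \<open>
  \<open>Leaf\<close> is the one-vertex tree (one leaf, no internal vertex) and \<open>Node []\<close> encodes the empty
  tree. In every other tree a vertex \<open>Node ts\<close> has at least one incoming edge. So exactly the
  terms satisfying \<open>is_tree\<close> are trees; a term with \<open>Node []\<close> at a non-root position only arises
  when the empty tree is glued to a leaf, and is turned into a tree by \<open>prune\<close>.
\<close>

datatype ptree = Leaf | Node "ptree list"

fun nonempty_tree :: "ptree \<Rightarrow> bool" where
  "nonempty_tree Leaf = True"
| "nonempty_tree (Node ts) = (ts \<noteq> [] \<and> (\<forall>t\<in>set ts. nonempty_tree t))"

definition is_tree :: "ptree \<Rightarrow> bool" where
  "is_tree p \<longleftrightarrow> p = Node [] \<or> nonempty_tree p"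

text \<open>
  A vertex is named by its address, the list of child positions on the path from the root. An
  edge is named by its upper end, so edges are the non-root vertices, and the edges incoming at
  \<open>v\<close> are \<open>v @ [0], v @ [1], \<dots>\<close>.
\<close>

type_synonym addr = "nat list"

fun sub_at :: "ptree \<Rightarrow> addr \<Rightarrow> ptree option" where
  "sub_at t [] = Some t"
| "sub_at Leaf (i # v) = None"
| "sub_at (Node ts) (i # v) = (if i < length ts then sub_at (ts ! i) v else None)"

fun replace_at :: "ptree \<Rightarrow> addr \<Rightarrow> ptree \<Rightarrow> ptree" where
  "replace_at t [] s = s"
| "replace_at Leaf (i # v) s = Leaf"
| "replace_at (Node ts) (i # v) s = Node (ts[i := replace_at (ts ! i) v s])"

definition vertices :: "ptree \<Rightarrow> addr set" where
  "vertices p = {v. sub_at p v \<noteq> None}"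

definition edges :: "ptree \<Rightarrow> addr set" where
  "edges p = vertices p - {[]}"

definition leaves :: "ptree \<Rightarrow> addr set" where
  "leaves p = {v. sub_at p v = Some Leaf}"

definition internals :: "ptree \<Rightarrow> addr set" where
  "internals p = vertices p - leaves p"

definition incoming :: "ptree \<Rightarrow> addr \<Rightarrow> addr set" where
  "incoming p v = {v @ [i] | i. v @ [i] \<in> vertices p}"

lemma size_nth_less [termination_simp]: "i < length ts \<Longrightarrow> size (ts ! i) < Suc (size_list size ts)"
  by (simp add: less_Suc_eq_le size_list_estimation'[OF nth_mem order.refl])

text \<open>Gluing the root of \<open>ps l\<close> to each leaf \<open>l\<close>; an empty \<open>ps l\<close> leaves a stump \<open>Node []\<close>.\<close>

fun graft :: "ptree \<Rightarrow> (addr \<Rightarrow> ptree) \<Rightarrow> ptree" where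
  "graft Leaf ps = ps []"
| "graft (Node ts) ps = Node (map (\<lambda>i. graft (ts ! i) (\<lambda>v. ps (i # v))) [0..<length ts])"

text \<open>
  Removing stumps. An internal vertex all of whose incoming edges disappear is removed as well,
  so that no new leaf is created.
\<close>

fun prune :: "ptree \<Rightarrow> ptree" where
  "prune Leaf = Leaf"
| "prune (Node ts) = Node (filter (\<lambda>t. t \<noteq> Node []) (map prune ts))"

definition surviving_edges :: "ptree \<Rightarrow> addr set" where
  "surviving_edges g = {e \<in> edges g. \<exists>t. sub_at g e = Some t \<and> prune t \<noteq> Node []}"

text \<open>The address in \<open>g\<close> of the vertex of \<open>prune g\<close> with a given address.\<close>

fun unprune_addr :: "ptree \<Rightarrow> addr \<Rightarrow> addr" where
  "unprune_addr (Node ts) (i # v) =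
     (filter (\<lambda>j. prune (ts ! j) \<noteq> Node []) [0..<length ts] ! i) #
     unprune_addr (ts ! (filter (\<lambda>j. prune (ts ! j) \<noteq> Node []) [0..<length ts] ! i)) v"
| "unprune_addr t v = v"


section \<open>Series in the edge variables\<close>

text \<open>
  \<open>F n\<close> is the coefficient at \<open>\<Prod>e. x\<^sub>e ^ n e\<close>. The localised power series modules are embedded into
  this space by the following expansion. The incoming edges \<open>e\<^sub>0, e\<^sub>1, \<dots>\<close> of a vertex being in
  planar order, \<open>(x\<^bsub>e\<^sub>i\<^esub> - x\<^bsub>e\<^sub>j\<^esub>)\<^sup>-\<^sup>1\<close> for \<open>i < j\<close> stands for its expansion in non-negative powers of
  \<open>x\<^bsub>e\<^sub>j\<^esub>\<close>. This embedding is injective, linear over the coefficients, and compatible with the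
  derivations and with multiplication by polynomials. Its image is singled out by two conditions:
  some power of the denominator multiplies the series into the original module, and \<open>expanded\<close>
  below. The latter says that for all other exponents fixed one has an iterated Laurent series, in
  \<open>B((x\<^bsub>e\<^sub>0\<^esub>))((x\<^bsub>e\<^sub>1\<^esub>))\<dots>\<close>; multiplication by \<open>x\<^bsub>e\<^sub>i\<^esub> - x\<^bsub>e\<^sub>j\<^esub>\<close> is injective on those.
\<close>

type_synonym 'b ser = "(addr \<Rightarrow> int) \<Rightarrow> 'b"

definition supp :: "(addr \<Rightarrow> int) \<Rightarrow> addr set" where
  "supp n = {e. n e \<noteq> 0}"

definition expanded :: "ptree \<Rightarrow> 'b::zero ser \<Rightarrow> bool" where
  "expanded p F \<longleftrightarrow> (\<forall>v i n. v @ [i] \<in> edges p \<longrightarrow>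
     (\<exists>b. \<forall>m. (\<forall>e. e \<notin> {v @ [j] | j. j \<le> i} \<longrightarrow> m e = n e) \<longrightarrow> F m \<noteq> 0 \<longrightarrow> b \<le> m (v @ [i])))"

text \<open>\<open>mult_diff E E'\<close> multiplies by \<open>(\<Sum>e\<in>E. x\<^sub>e) - (\<Sum>e\<in>E'. x\<^sub>e)\<close>.\<close>

definition mult_diff :: "addr set \<Rightarrow> addr set \<Rightarrow> 'b::ab_group_add ser \<Rightarrow> 'b ser" where
  "mult_diff E E' F =
     (\<lambda>n. (\<Sum>e\<in>E. F (n(e := n e - 1))) - (\<Sum>e\<in>E'. F (n(e := n e - 1))))"

text \<open>
  Multiplication by \<open>\<Prod>\<^bsub>i\<noteq>j\<^esub> (s\<^sub>i - s\<^sub>j)\<^sup>N\<close>, where \<open>i, j < r\<close> and \<open>s\<^sub>i\<close> is the sum of the variables in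
  \<open>s i\<close>. Both \<open>s\<^sub>i - s\<^sub>j\<close> and \<open>s\<^sub>j - s\<^sub>i\<close> are used, so that the product is invariant under permutations.
\<close>

definition clear_denoms :: "nat \<Rightarrow> (nat \<Rightarrow> addr set) \<Rightarrow> nat \<Rightarrow> 'b::ab_group_add ser \<Rightarrow> 'b ser" where
  "clear_denoms r s N F =
     fold (\<lambda>(i, j). mult_diff (s i) (s j) ^^ N) [(i, j). i \<leftarrow> [0..<r], j \<leftarrow> [0..<r], i \<noteq> j] F"


section \<open>Singular multilinear maps\<close>

text \<open>
  A map takes an assignment of inputs to the leaves, and yields a series in the edge variables.
  All inputs are taken from the module \<open>B\<close> in which the map has its values, which is the case needed
  for algebras.
\<close>

type_synonym 'b mmap = "(addr \<Rightarrow> 'b) \<Rightarrow> 'b ser"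

text \<open>
  Evaluation at an element of \<open>X\<^bsub>q,i\<^esub>\<close>, where \<open>e\<close> is the \<open>i\<close>-th edge incoming at \<open>q\<close>. If \<open>e\<close> ends in a
  leaf, the element is the input \<open>c\<close>. Otherwise it is the basis element \<open>D\<^bsup>(k\<^sub>1)\<^esup> \<otimes> D\<^bsup>(k\<^sub>2)\<^esup> \<otimes> \<dots>\<close> of a
  tensor power of \<open>H\<close>, and evaluation picks out a coefficient with respect to the variables of the
  edges incoming at the upper end of \<open>e\<close>.
\<close>

definition feed :: "ptree \<Rightarrow> addr \<Rightarrow> 'b \<Rightarrow> (addr \<Rightarrow> nat) \<Rightarrow> 'b mmap \<Rightarrow> 'b mmap" where
  "feed p e c k F = (\<lambda>a n.
     if e \<in> leaves p then F (a(e := c)) n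
     else F a (\<lambda>e'. if e' \<in> incoming p e then int (k e') else n e'))"

text \<open>
  The iterated Hom in the definition of \<open>Sing\<^bsub>\<sigma>,q\<^esub>(M)\<close>, with \<open>M\<close> given by its membership predicate.
  \<open>prev\<close> contains the edges introduced so far. The first conjunct says that one has a map out of
  \<open>H\<^bsup>\<otimes>r'\<^esup>\<close>, i.e. a power series in the variables belonging to \<open>H\<^bsup>\<otimes>r'\<^esup>\<close> (it is void if \<open>e\<close> ends in a
  leaf). By linearity it is enough to let the elements of the tensor product range over pure
  tensors and over the basis of \<open>H\<^bsup>\<otimes>r'\<^esup>\<close>. For the first edge there is no denominator, so the first
  two inputs may be treated one after the other.
\<close>

fun sing_stages :: "ptree \<Rightarrow> addr list \<Rightarrow> addr list \<Rightarrow> ('b::ab_group_add mmap \<Rightarrow> bool) \<Rightarrow> 'b mmap \<Rightarrow> bool"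
where
  "sing_stages p prev [] M F = M F"
| "sing_stages p prev (e # es) M F =
     ((\<forall>a n. (\<exists>e'\<in>incoming p e. n e' < 0) \<longrightarrow> F a n = 0) \<and>
      (\<forall>c k. \<exists>N. sing_stages p (prev @ [e]) es M
         (\<lambda>a. fold (\<lambda>e'. mult_diff {e'} {e} ^^ N) prev (feed p e c k F a))))"

definition Sing :: "ptree \<Rightarrow> addr \<Rightarrow> ('b::ab_group_add mmap \<Rightarrow> bool) \<Rightarrow> 'b mmap \<Rightarrow> bool" where
  "Sing p v M F \<longleftrightarrow> (\<forall>\<sigma>. \<sigma> permutes {..<card (incoming p v)} \<and> evenperm \<sigma> \<longrightarrow>
     sing_stages p [] (map (\<lambda>i. v @ [\<sigma> i]) [0..<card (incoming p v)]) M F)"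

definition root_series :: "ptree \<Rightarrow> 'b::zero mmap \<Rightarrow> bool" where
  "root_series p F \<longleftrightarrow> (\<forall>a n. (\<exists>e\<in>incoming p []. n e < 0) \<longrightarrow> F a n = 0)"

definition total_order_of :: "ptree \<Rightarrow> addr list \<Rightarrow> bool" where
  "total_order_of p t \<longleftrightarrow> distinct t \<and> set t = internals p \<and>
     sorted_wrt (\<lambda>v w. \<not> strict_prefix w v) t"

definition Ord :: "ptree \<Rightarrow> addr list \<Rightarrow> 'b::ab_group_add mmap \<Rightarrow> bool" where
  "Ord p t = fold (Sing p) t (root_series p)"

context G_module
begin

definition deriv_var :: "addr \<Rightarrow> 'b ser \<Rightarrow> 'b ser" where
  "deriv_var e F = (\<lambda>n. of_int (n e + 1) *s F (n(e := n e + 1)))"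

text \<open>
  \<open>T\<close> acting at a vertex: it corresponds to the derivative with respect to the edge leading to that
  vertex, and to \<open>T\<^sub>B\<close> on the values if the vertex is the root. In particular at an internal root the
  condition \<open>T_compatible\<close> is \<open>G\<close>-invariance; for \<open>Leaf\<close> it says that the map is \<open>H\<close>-linear, and
  for the empty tree that the vector is killed by \<open>T\<close>.
\<close>

definition T_below :: "addr \<Rightarrow> 'b ser \<Rightarrow> 'b ser" where
  "T_below v F = (if v = [] then (\<lambda>n. T (F n)) else deriv_var v F)"

definition T_compatible :: "ptree \<Rightarrow> 'b mmap \<Rightarrow> bool" where
  "T_compatible p F \<longleftrightarrow>
     (\<forall>l\<in>leaves p. \<forall>a. F (a(l := T (a l))) = T_below l (F a)) \<and>
     (\<forall>v\<in>internals p. \<forall>a n. (\<Sum>e\<in>incoming p v. deriv_var e (F a) n) = T_below v (F a) n)"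

text \<open>
  \<open>F\<close> is an element of \<open>Multi\<^sup>K\<^bsub>G,p\<^esub>(B,\<dots>,B;B)\<close>. All \<open>Ord\<^sub>t\<close> are subspaces of the same space of maps
  into series, so their wide pullback is their intersection.
\<close>

definition Multi :: "ptree \<Rightarrow> 'b mmap \<Rightarrow> bool" where
  "Multi p F \<longleftrightarrow>
     (\<forall>a a'. (\<forall>l\<in>leaves p. a l = a' l) \<longrightarrow> F a = F a') \<and>
     (\<forall>a n. F a n \<noteq> 0 \<longrightarrow> supp n \<subseteq> edges p) \<and>
     (\<forall>l\<in>leaves p. \<forall>a n. Vector_Spaces.linear scale scale (\<lambda>c. F (a(l := c)) n)) \<and>
     T_compatible p F \<and>
     (\<forall>a. expanded p (F a)) \<and>
     (\<forall>t. total_order_of p t \<longrightarrow> Ord p t F)"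

end


section \<open>Composition, refinement and permutation\<close>

definition compose :: "ptree \<Rightarrow> 'b mmap \<Rightarrow> (addr \<Rightarrow> 'b mmap) \<Rightarrow> 'b mmap" where
  "compose q F Gs = (\<lambda>a n.
     F (\<lambda>l. Gs l (\<lambda>u. a (l @ u)) (\<lambda>u. if u = [] then 0 else n (l @ u)))
       (\<lambda>e. if e \<in> edges q then n e else 0))"

text \<open>
  A map for \<open>prune g\<close>, viewed as a map for \<open>g\<close> which does not depend on the variables of the
  removed edges.
\<close>

definition unprune :: "ptree \<Rightarrow> 'b::zero mmap \<Rightarrow> 'b mmap" where
  "unprune g F = (\<lambda>a n.
     if supp n \<subseteq> surviving_edges g
     then F (\<lambda>v. a (unprune_addr g v)) (\<lambda>e. if e \<in> edges (prune g) then n (unprune_addr g e) else 0)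
     else 0)"

definition relocate :: "addr \<Rightarrow> (addr \<Rightarrow> addr) \<Rightarrow> addr \<Rightarrow> addr" where
  "relocate v h u = (if prefix v u then v @ h (drop (length v) u) else u)"

text \<open>
  Let \<open>p\<close> arise from \<open>q\<close> by shrinking the edge \<open>y = v @ [i]\<close>, whose upper end has \<open>m\<close> incoming
  edges. \<open>shrink_addr v i m\<close> sends a vertex of \<open>p\<close> to the corresponding vertex of \<open>q\<close>; in particular
  it sends the edges \<open>w\<^sub>k = v @ [i + k]\<close> of \<open>p\<close> to the edges \<open>z\<^sub>k = v @ [i, k]\<close> of \<open>q\<close>.
\<close>

fun shrink_tail :: "nat \<Rightarrow> nat \<Rightarrow> addr \<Rightarrow> addr" where
  "shrink_tail i m [] = []"
| "shrink_tail i m (j # w) =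
     (if j < i then j # w else if j < i + m then i # (j - i) # w else (Suc j - m) # w)"

definition shrink_addr :: "addr \<Rightarrow> nat \<Rightarrow> nat \<Rightarrow> addr \<Rightarrow> addr" where
  "shrink_addr v i m = relocate v (shrink_tail i m)"

context G_module
begin

text \<open>
  Substituting \<open>w\<^sub>k \<mapsto> z\<^sub>k + y\<close> in a power series \<open>P\<close>: the coefficient of
  \<open>y\<^sup>d \<Prod>k. z\<^sub>k ^ c\<^sub>k\<close> in \<open>\<Prod>k. (z\<^sub>k + y) ^ (c\<^sub>k + l\<^sub>k)\<close> is \<open>\<Prod>k. (c\<^sub>k + l\<^sub>k choose l\<^sub>k)\<close> if \<open>\<Sum>k. l\<^sub>k = d\<close>.
\<close>

definition subst_shrink :: "addr \<Rightarrow> nat \<Rightarrow> nat \<Rightarrow> 'b ser \<Rightarrow> 'b ser" where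
  "subst_shrink v i m P = (\<lambda>n.
     if n (v @ [i]) < 0 \<or> (\<exists>k<m. n (v @ [i, k]) < 0) then 0
     else \<Sum>l\<in>{l. (\<forall>e. e \<notin> {v @ [i + k] | k. k < m} \<longrightarrow> l e = 0)
               \<and> (\<Sum>k<m. l (v @ [i + k])) = nat (n (v @ [i]))}.
       (\<Prod>k<m. of_nat ((nat (n (v @ [i, k])) + l (v @ [i + k])) choose l (v @ [i + k])))
       *s P (\<lambda>e. n (shrink_addr v i m e) + int (l e)))"

text \<open>
  \<open>r\<^bsub>p,q\<^esub> F = G\<close> for \<open>p\<close> as above, where \<open>r\<close> is the number of edges incoming at \<open>v\<close> in \<open>p\<close>. If
  \<open>F = P / \<Prod>(w - w')\<^sup>N\<close>, then \<open>G\<close> is obtained by substituting \<open>z\<^sub>k + y\<close> for \<open>w\<^sub>k\<close> in numerator and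
  denominator. The expansion of the new denominators, in non-negative powers of the \<open>z\<^sub>k\<close> up to powers
  of \<open>z\<^sub>k - z\<^sub>l\<close>, is forced by \<open>G\<close> belonging to \<open>Multi\<^sup>K\<^bsub>G,q\<^esub>\<close>. Exponents of the remaining variables are
  kept fixed (\<open>n\<^sub>0\<close>), as \<open>N\<close> depends on those of the variables above \<open>v\<close>.
\<close>

definition refines_shrink :: "ptree \<Rightarrow> addr \<Rightarrow> nat \<Rightarrow> nat \<Rightarrow> nat \<Rightarrow> 'b mmap \<Rightarrow> 'b mmap \<Rightarrow> bool" where
  "refines_shrink q v i m r F G \<longleftrightarrow> Multi q G \<and>
     (\<forall>a n\<^sub>0. \<exists>N P.
        P = clear_denoms r (\<lambda>j. {v @ [j]}) N (F (\<lambda>u. a (shrink_addr v i m u))) \<and>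
        (\<forall>n. (\<forall>e. e \<notin> {v @ [j] | j. j < r} \<longrightarrow> n e = n\<^sub>0 (shrink_addr v i m e)) \<longrightarrow>
             (\<exists>j<r. n (v @ [j]) < 0) \<longrightarrow> P n = 0) \<and>
        (\<forall>n. supp n \<subseteq> edges q \<longrightarrow>
             (\<forall>e. e \<notin> incoming q v \<union> incoming q (v @ [i]) \<longrightarrow> n e = n\<^sub>0 e) \<longrightarrow>
             clear_denoms r
               (\<lambda>j. if i \<le> j \<and> j < i + m then {v @ [i, j - i], v @ [i]}
                    else {shrink_addr v i m (v @ [j])}) N (G a) n
             = subst_shrink v i m P n))"

text \<open>\<open>r\<^bsub>p,q\<^esub> F = G\<close> for the one-vertex tree \<open>p\<close> and the flat one-leafed tree \<open>q\<close>: \<open>G = e\<^bsup>Tx\<^esup> F\<close>.\<close>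

definition refines_vertex_edge :: "'b mmap \<Rightarrow> 'b mmap \<Rightarrow> bool" where
  "refines_vertex_edge F G \<longleftrightarrow> Multi (Node [Leaf]) G \<and>
     (\<forall>a k. G a (\<lambda>e. if e = [0] then int k else 0) =
        (1 / fact k) *s (T ^^ k) (F (\<lambda>u. a [0]) (\<lambda>e. 0)))"

end

text \<open>
  Permutation of the subtrees at a vertex \<open>v\<close> with \<open>r\<close> incoming edges: the \<open>j\<close>-th subtree of the new
  tree \<open>p'\<close> is the \<open>\<pi> j\<close>-th subtree of \<open>p\<close>, and \<open>F' (a\<^sub>\<pi>)(x\<^sub>\<pi>) = F(a)(x)\<close> in the localised module.
  The expansions of denominators in \<open>p\<close> and \<open>p'\<close> differ, hence numerators are compared.
\<close>

fun perm_tail :: "(nat \<Rightarrow> nat) \<Rightarrow> addr \<Rightarrow> addr" where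
  "perm_tail \<pi> [] = []"
| "perm_tail \<pi> (j # w) = \<pi> j # w"

definition perm_addr :: "addr \<Rightarrow> (nat \<Rightarrow> nat) \<Rightarrow> addr \<Rightarrow> addr" where
  "perm_addr v \<pi> = relocate v (perm_tail \<pi>)"

definition permuted :: "addr \<Rightarrow> nat \<Rightarrow> (nat \<Rightarrow> nat) \<Rightarrow> 'b::ab_group_add mmap \<Rightarrow> 'b mmap \<Rightarrow> bool" where
  "permuted v r \<pi> F F' \<longleftrightarrow>
     (\<forall>a n\<^sub>0. \<exists>N P P'.
        P = clear_denoms r (\<lambda>j. {v @ [j]}) N (F a) \<and>
        P' = clear_denoms r (\<lambda>j. {v @ [j]}) N (F' (\<lambda>u. a (perm_addr v \<pi> u))) \<and>
        (\<forall>n. (\<forall>e. e \<notin> {v @ [j] | j. j < r} \<longrightarrow> n e = n\<^sub>0 e) \<longrightarrow>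
             ((\<exists>j<r. n (v @ [j]) < 0) \<longrightarrow> P n = 0) \<and>
             P' (\<lambda>e. n (perm_addr v \<pi> e)) = P n))"


section \<open>Algebras\<close>

text \<open>
  \<open>f (Node []) a n\<close> does not depend on \<open>a\<close> and is concentrated at \<open>n = 0\<close>; its value there is
  \<open>f\<^sub>\<circ>(1)\<close>. In \<open>composition\<close> the trees \<open>ps l\<close> may be empty. The unit axiom is the case where
  \<open>ps l = Node []\<close> for one leaf \<open>l\<close> and \<open>ps l = Leaf\<close> for the others, since \<open>f Leaf\<close> is the identity.
  As the refinement maps are composites of those for single moves, it suffices to state the
  refinement axiom for the latter. Replacing a vertex with one incoming edge by an edge is
  shrinking an internal edge, except for passing from \<open>Node [Leaf]\<close> to \<open>Leaf\<close>.
\<close>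

locale relaxed_algebra = G_module scale T
  for scale :: "complex \<Rightarrow> 'b::ab_group_add \<Rightarrow> 'b" (infixr "*s" 75) and T :: "'b \<Rightarrow> 'b" +
  fixes f :: "ptree \<Rightarrow> 'b mmap"
  assumes multi: "is_tree p \<Longrightarrow> Multi p (f p)"
    and identity: "f Leaf a (\<lambda>e. 0) = a []"
    and composition:
      "\<lbrakk>is_tree q; \<forall>l\<in>leaves q. is_tree (ps l); supp n \<subseteq> edges (graft q ps)\<rbrakk> \<Longrightarrow>
       unprune (graft q ps) (f (prune (graft q ps))) a n = compose q (f q) (\<lambda>l. f (ps l)) a n"
    and refinement_shrink:
      "\<lbrakk>is_tree q; sub_at q v = Some (Node ts); i < length ts; ts ! i = Node us;
        ts' = take i ts @ us @ drop (Suc i) ts\<rbrakk> \<Longrightarrow>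
       refines_shrink q v i (length us) (length ts') (f (replace_at q v (Node ts'))) (f q)"
    and refinement_vertex_edge: "refines_vertex_edge (f Leaf) (f (Node [Leaf]))"

locale commutative_relaxed_algebra = relaxed_algebra scale T f
  for scale :: "complex \<Rightarrow> 'b::ab_group_add \<Rightarrow> 'b" (infixr "*s" 75) and T :: "'b \<Rightarrow> 'b"
    and f :: "ptree \<Rightarrow> 'b mmap" +
  assumes symmetric:
      "\<lbrakk>is_tree p; sub_at p v = Some (Node ts); \<pi> permutes {..<length ts}\<rbrakk> \<Longrightarrow>
       permuted v (length ts) \<pi> (f p)
         (f (replace_at p v (Node (map (\<lambda>j. ts ! \<pi> j) [0..<length ts]))))"

definition vacuum_vector :: "(ptree \<Rightarrow> 'b::zero mmap) \<Rightarrow> 'b" where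
  "vacuum_vector f = f (Node []) (\<lambda>_. 0) (\<lambda>_. 0)"

text \<open>
  The coefficient of \<open>x\<^sup>n\<close> in \<open>f\<^sub>2(a \<otimes> b)\<close> at \<open>y = 0\<close>, with \<open>x, y\<close> the variables of the edges \<open>[0]\<close> and
  \<open>[1]\<close>. As \<open>(x - y)\<^sup>-\<^sup>1\<close> stands for its expansion in non-negative powers of \<open>y\<close>, this is the
  coefficient of \<open>x\<^sup>n y\<^sup>0\<close>.
\<close>

definition f2_at_y_zero :: "(ptree \<Rightarrow> 'b mmap) \<Rightarrow> 'b \<Rightarrow> 'b \<Rightarrow> int \<Rightarrow> 'b" where
  "f2_at_y_zero f a b n =
     f (Node [Leaf, Leaf]) (\<lambda>l. if l = [0] then a else b) (\<lambda>e. if e = [0] then n else 0)"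

end

theory Submission
  imports Defs
begin

text \<open>
  Vacuum and translation axioms come from small trees. Gluing the empty tree to one leaf of the
  two-leafed flat tree leaves the one-leafed flat tree, whose map is \<open>a \<mapsto> e\<^bsup>Tx\<^esup> a\<close>. This gives
  \<open>Y(|0>, x) a = a\<close>, and \<open>Y(a, x)|0>\<close> is a power series with constant term \<open>a\<close>. Translation
  covariance is \<open>G\<close>-invariance of \<open>f\<^sub>2\<close> together with its linearity over \<open>H\<close> in the second slot,
  evaluated at \<open>y = 0\<close>.
  
  Locality rests on the map \<open>f\<^sub>3\<close> of the flat tree with three leaves. Composition says that
  \<open>Y(a, x) Y(b, z) c\<close> is the map of the tree \<open>(\<bullet>, (\<bullet>, \<bullet>))\<close> at two vanishing variables, and
  shrinking the internal edge of this tree gives \<open>f\<^sub>3\<close>. Hence \<open>Y(a, x) Y(b, z) c\<close> is the expansion of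
  \<open>f\<^sub>3(a, b, c)(x, z, 0)\<close> in the domain \<open>|x| > |z|\<close> (\<open>iterated_field_eq_three_point\<close>). By symmetry
  \<open>Y(b, z) Y(a, x) c\<close> is the expansion of the same element in the domain \<open>|z| > |x|\<close>: the numerators
  of the two series agree (\<open>three_point_symmetric\<close>). Finally \<open>f\<^sub>3\<close> is a singular multilinear map, so
  the order \<open>N\<close> of its pole along \<open>x = z\<close> depends on \<open>a\<close> and \<open>b\<close> alone
  (\<open>three_point_pole_uniform\<close>). Multiplying by \<open>(x - z)\<^sup>N\<close> therefore leaves poles in \<open>x\<close> and \<open>z\<close> only, for
  which the two expansions coincide.
  
  All these comparisons take place between formal distributions, where a product of linear forms
  can be cancelled only inside a suitable half-bounded subspace. The bookkeeping consists in
  restricting series to two variables (\<open>slice\<close>), where clearing denominators becomes multiplication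
  by linear forms \<open>\<alpha> x + \<beta> z\<close> (\<open>slice_clear_denoms\<close>), and in cancelling these forms
  (\<open>mult_linears_cancel\<close>).
\<close>

section \<open>Restricting series to two variables\<close>

definition swap :: "(int \<Rightarrow> int \<Rightarrow> 'b) \<Rightarrow> int \<Rightarrow> int \<Rightarrow> 'b" where
  "swap F = (\<lambda>i j. F j i)"

text \<open>
  The part of a series in the variables of \<open>e\<close> and \<open>e'\<close> at the exponents \<open>n\<close> of all other variables.
  If only non-negative exponents occur elsewhere, then \<open>n = 0\<close> puts all other variables equal to \<open>0\<close>.
\<close>

definition slice :: "addr \<Rightarrow> addr \<Rightarrow> (addr \<Rightarrow> int) \<Rightarrow> 'b ser \<Rightarrow> int \<Rightarrow> int \<Rightarrow> 'b" where
  "slice e e' n H = (\<lambda>i j. H (n(e := i, e' := j)))"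

text \<open>
  Multiplication by \<open>x\<^sub>d\<close> raises an exponent. So for \<open>d \<in> S\<close> and a series vanishing below \<open>n\<close>, the product
  with \<open>x\<^sub>d\<close> contributes nothing at the exponent \<open>n d\<close>. In this way restriction to the lowest exponents
  is compatible with multiplication, where it amounts to \<open>x\<^sub>d = 0\<close>.
\<close>

definition vanishes_below :: "addr set \<Rightarrow> (addr \<Rightarrow> int) \<Rightarrow> 'b::zero ser \<Rightarrow> bool" where
  "vanishes_below S n H \<longleftrightarrow> (\<forall>k. (\<exists>d\<in>S. k d < n d) \<longrightarrow> H k = 0)"

text \<open>
  Membership in \<open>B[[x, x\<^sup>-\<^sup>1]]((z))\<close>: one bound on the poles in \<open>z\<close> serves for all powers of \<open>x\<close>.
\<close>

definition bounded_snd :: "(int \<Rightarrow> int \<Rightarrow> 'b::zero) \<Rightarrow> bool" where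
  "bounded_snd F \<longleftrightarrow> (\<exists>b. \<forall>i j. j < b \<longrightarrow> F i j = 0)"

lemma bounded_sndI: "(\<And>i j. j < b \<Longrightarrow> F i j = 0) \<Longrightarrow> bounded_snd F"
  unfolding bounded_snd_def by blast

lemma vanishes_below_mult_diff:
  assumes "vanishes_below S n H"
  shows "vanishes_below S n (mult_diff E E' H)"
proof -
  have "H (k(e := k e - 1)) = 0" if "d \<in> S" "k d < n d" for k d e
  proof -
    have "(k(e := k e - 1)) d < n d" using that by auto
    then show ?thesis using assms that(1) unfolding vanishes_below_def by blast
  qed
  then show ?thesis
    unfolding vanishes_below_def mult_diff_def by (auto intro!: sum.neutral)
qed

lemma vanishes_below_mult_diff_funpow:
  "vanishes_below S n H \<Longrightarrow> vanishes_below S n ((mult_diff E E' ^^ N) H)"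
  by (induction N) (auto intro: vanishes_below_mult_diff)

lemma vanishes_below_step:
  assumes below: "vanishes_below {d} (n(d := b)) H"
    and slice: "slice e e' (n(d := b)) H = (\<lambda>i j. 0)"
    and off: "\<And>k. H k \<noteq> 0 \<Longrightarrow> \<forall>u. u \<notin> {e, e', d} \<longrightarrow> k u = n u"
    and "d \<noteq> e" "d \<noteq> e'"
  shows "vanishes_below {d} (n(d := b + 1)) H"
proof -
  have "H k = 0" if "k d < b + 1" for k
  proof (cases "k d < b")
    case True
    then show ?thesis using below unfolding vanishes_below_def by simp
  next
    case False
    show ?thesis
    proof (rule ccontr)
      assume "H k \<noteq> 0"
      from off[OF this] False that have "k = (n(d := b))(e := k e, e' := k e')"
        by (auto simp: fun_eq_iff)
      moreover have "H ((n(d := b))(e := k e, e' := k e')) = 0"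
        using slice unfolding slice_def by meson
      ultimately show False using \<open>H k \<noteq> 0\<close> by simp
    qed
  qed
  then show ?thesis unfolding vanishes_below_def by simp
qed

text \<open>
  The lowest exponent of \<open>x\<^sub>d\<close> can be raised step by step as long as the lowest coefficient vanishes.
  This is how negative powers of the last variable of a flat tree are excluded.
\<close>

lemma vanishes_below_zero:
  assumes "\<exists>b. vanishes_below {d} (n(d := b)) H"
    and "\<And>b. \<lbrakk>b < 0; vanishes_below {d} (n(d := b)) H\<rbrakk> \<Longrightarrow> slice e e' (n(d := b)) H = (\<lambda>i j. 0)"
    and off: "\<And>k. H k \<noteq> 0 \<Longrightarrow> \<forall>u. u \<notin> {e, e', d} \<longrightarrow> k u = n u"
    and ne: "d \<noteq> e" "d \<noteq> e'"
    and "n d = 0"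
  shows "vanishes_below {d} n H"
proof -
  obtain b where b: "vanishes_below {d} (n(d := b)) H" using assms(1) by blast
  have "vanishes_below {d} (n(d := min 0 (b + int i))) H" for i
  proof (induction i)
    case 0
    then show ?case using b unfolding vanishes_below_def by auto
  next
    case (Suc i)
    show ?case
    proof (cases "b + int i < 0")
      case True
      then have "min 0 (b + int i) = b + int i" by simp
      with Suc have "vanishes_below {d} (n(d := b + int i)) H" by metis
      then have "vanishes_below {d} (n(d := b + int i + 1)) H"
        using True by (intro vanishes_below_step[where e = e and e' = e'] assms)
      moreover have "min 0 (b + int (Suc i)) = b + int i + 1" using True by simp
      ultimately show ?thesis by metis
    next
      case False
      then show ?thesis using Suc by simp
    qed
  qed
  from this[of "nat (- b)"] have "vanishes_below {d} (n(d := n d)) H"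
    using assms(6) by (cases "b \<le> 0") auto
  then show ?thesis by simp
qed

section \<open>Cancelling linear forms\<close>

context G_module
begin

text \<open>
  Multiplication by \<open>\<alpha> x + \<beta> z\<close>.
\<close>

definition mult_linear ::
    "complex \<Rightarrow> complex \<Rightarrow> (int \<Rightarrow> int \<Rightarrow> 'b) \<Rightarrow> int \<Rightarrow> int \<Rightarrow> 'b" where
  "mult_linear \<alpha> \<beta> F = (\<lambda>i j. \<alpha> *s F (i - 1) j + \<beta> *s F i (j - 1))"

lemma mult_linear_commute:
  "mult_linear \<alpha> \<beta> (mult_linear \<gamma> \<delta> F) = mult_linear \<gamma> \<delta> (mult_linear \<alpha> \<beta> F)"
  by (simp add: mult_linear_def scale_right_distrib mult.commute add.commute add.left_commute
      add.assoc)

lemma mult_linear_funpow_commute1: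
  "mult_linear \<alpha> \<beta> ((mult_linear \<gamma> \<delta> ^^ N) F) = (mult_linear \<gamma> \<delta> ^^ N) (mult_linear \<alpha> \<beta> F)"
  by (induction N) (simp_all add: mult_linear_commute[of \<alpha> \<beta>])

lemma mult_linear_funpow_commute:
  "(mult_linear \<alpha> \<beta> ^^ M) ((mult_linear \<gamma> \<delta> ^^ N) F) =
   (mult_linear \<gamma> \<delta> ^^ N) ((mult_linear \<alpha> \<beta> ^^ M) F)"
  by (induction M) (simp_all add: mult_linear_funpow_commute1)

lemma swap_mult_linear_funpow:
  "swap ((mult_linear \<alpha> \<beta> ^^ N) F) = (mult_linear \<beta> \<alpha> ^^ N) (swap F)"
  by (induction N) (simp_all add: mult_linear_def swap_def fun_eq_iff add.commute)

lemma bounded_snd_mult_linear_funpow: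
  "bounded_snd F \<Longrightarrow> bounded_snd ((mult_linear \<alpha> \<beta> ^^ N) F)"
proof (induction N)
  case (Suc N)
  then obtain b where "\<And>i j. j < b \<Longrightarrow> (mult_linear \<alpha> \<beta> ^^ N) F i j = 0"
    unfolding bounded_snd_def by blast
  then show ?case by (intro bounded_sndI[of b]) (simp add: mult_linear_def[of _ _ "(_ ^^ _) _"])
qed simp

text \<open>
  If \<open>\<alpha> \<noteq> 0\<close>, the coefficient at the lowest power of \<open>z\<close> is multiplied by \<open>\<alpha> x\<close>, which is a unit on
  \<open>B[[x, x\<^sup>-\<^sup>1]]\<close>. So coefficients are determined by induction on the power of \<open>z\<close>. Without a bound on
  the powers of \<open>z\<close>, the delta distribution, which \<open>x - z\<close> annihilates, would be a counterexample.
\<close>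

lemma mult_linear_cancel:
  assumes "bounded_snd F" "bounded_snd G" "\<alpha> \<noteq> 0 \<or> \<beta> \<noteq> 0"
    and eq: "mult_linear \<alpha> \<beta> F = mult_linear \<alpha> \<beta> G"
  shows "F = G"
proof -
  have *: "\<alpha> *s F (i - 1) j + \<beta> *s F i (j - 1) = \<alpha> *s G (i - 1) j + \<beta> *s G i (j - 1)" for i j
    using eq unfolding mult_linear_def by meson
  show ?thesis
  proof (cases "\<alpha> = 0")
    case True
    then show ?thesis using assms(3) *[of _ "_ + 1"] by (auto simp: fun_eq_iff)
  next
    case False
    obtain b c where b: "\<And>i j. j < b \<Longrightarrow> F i j = 0" and c: "\<And>i j. j < c \<Longrightarrow> G i j = 0"
      using assms(1,2) unfolding bounded_snd_def by blast
    have "\<forall>i. F i (min b c - 1 + int l) = G i (min b c - 1 + int l)" for l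
    proof (induction l)
      case 0
      then show ?case using b c by simp
    next
      case (Suc l)
      have "F i (min b c - 1 + int (Suc l)) = G i (min b c - 1 + int (Suc l))" for i
        using *[of "i + 1" "min b c - 1 + int (Suc l)"] Suc[rule_format, of "i + 1"] False
        by (simp add: algebra_simps)
      then show ?case by blast
    qed
    then have l: "F i (min b c - 1 + int l) = G i (min b c - 1 + int l)" for i l by blast
    have "F i j = G i j" for i j
    proof (cases "j < min b c")
      case True
      then show ?thesis using b c by simp
    next
      case False
      then show ?thesis using l[of i "nat (j - min b c + 1)"] by (simp split: if_splits) linarith
    qed
    then show ?thesis by blast
  qed
qed

lemma mult_linear_funpow_cancel:
  assumes "bounded_snd F" "bounded_snd G" "\<alpha> \<noteq> 0 \<or> \<beta> \<noteq> 0"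
    and "(mult_linear \<alpha> \<beta> ^^ N) F = (mult_linear \<alpha> \<beta> ^^ N) G"
  shows "F = G"
  using assms(4)
proof (induction N)
  case (Suc N)
  have "(mult_linear \<alpha> \<beta> ^^ N) F = (mult_linear \<alpha> \<beta> ^^ N) G"
    by (rule mult_linear_cancel[OF bounded_snd_mult_linear_funpow bounded_snd_mult_linear_funpow])
      (use assms Suc.prems in simp_all)
  then show ?case by (rule Suc.IH)
qed simp

text \<open>
  A monomial only shifts coefficients, so it can be cancelled from arbitrary distributions.
\<close>

lemma mult_x_funpow_cancel:
  assumes "(mult_linear 1 0 ^^ N) F = (mult_linear 1 0 ^^ N) G"
  shows "F = G"
proof -
  have "(mult_linear 1 0 ^^ N) F (i + int N) j = F i j" for F i j
    by (induction N arbitrary: i) (simp_all add: mult_linear_def)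
  then show ?thesis using assms by (metis ext)
qed

lemma mult_z_funpow_cancel:
  assumes "(mult_linear 0 1 ^^ N) F = (mult_linear 0 1 ^^ N) G"
  shows "F = G"
proof -
  have "(mult_linear 0 1 ^^ N) F i (j + int N) = F i j" for F i j
    by (induction N arbitrary: j) (simp_all add: mult_linear_def)
  then show ?thesis using assms by (metis ext)
qed

text \<open>
  Multiplication by the \<open>N\<close>-th power of a product of linear forms, given by their coefficients.
\<close>

definition mult_linears ::
    "nat \<Rightarrow> (complex \<times> complex) list \<Rightarrow> (int \<Rightarrow> int \<Rightarrow> 'b) \<Rightarrow> int \<Rightarrow> int \<Rightarrow> 'b" where
  "mult_linears N cs = fold (\<lambda>(\<alpha>, \<beta>). mult_linear \<alpha> \<beta> ^^ N) cs"

lemma mult_linears_Cons: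
  "mult_linears N ((\<alpha>, \<beta>) # cs) F = mult_linears N cs ((mult_linear \<alpha> \<beta> ^^ N) F)"
  by (simp add: mult_linears_def)

lemma mult_linears_cancel:
  assumes "bounded_snd F" "bounded_snd G" "(0, 0) \<notin> set cs"
    and "mult_linears N cs F = mult_linears N cs G"
  shows "F = G"
  using assms
proof (induction cs arbitrary: F G)
  case Nil
  then show ?case by (simp add: mult_linears_def)
next
  case (Cons c cs)
  obtain \<alpha> \<beta> where c: "c = (\<alpha>, \<beta>)" by fastforce
  have "(mult_linear \<alpha> \<beta> ^^ N) F = (mult_linear \<alpha> \<beta> ^^ N) G"
  proof (rule Cons.IH)
    show "bounded_snd ((mult_linear \<alpha> \<beta> ^^ N) F)" "bounded_snd ((mult_linear \<alpha> \<beta> ^^ N) G)"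
      using Cons.prems by (auto intro: bounded_snd_mult_linear_funpow)
  qed (use Cons.prems in \<open>simp_all add: c mult_linears_Cons\<close>)
  moreover have "\<alpha> \<noteq> 0 \<or> \<beta> \<noteq> 0" using Cons.prems(3) c by auto
  ultimately show ?case using Cons.prems(1,2) mult_linear_funpow_cancel by blast
qed

lemma mult_linears_commute:
  "mult_linears N cs ((mult_linear \<alpha> \<beta> ^^ M) F) = (mult_linear \<alpha> \<beta> ^^ M) (mult_linears N cs F)"
proof (induction cs arbitrary: F)
  case Nil
  then show ?case by (simp add: mult_linears_def)
next
  case (Cons c cs)
  obtain \<gamma> \<delta> where c: "c = (\<gamma>, \<delta>)" by fastforce
  show ?case unfolding c mult_linears_Cons mult_linear_funpow_commute[of N \<gamma> \<delta> M \<alpha> \<beta>] by (rule Cons.IH)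
qed

lemma mult_linears_permute: "mset cs = mset ds \<Longrightarrow> mult_linears N cs = mult_linears N ds"
  unfolding mult_linears_def
  by (rule fold_multiset_equiv) (auto simp: fun_eq_iff mult_linear_funpow_commute)

text \<open>
  Exchanging \<open>x\<close> and \<open>z\<close> carries the cancellation property over to distributions bounded in \<open>x\<close>.
\<close>

lemma swap_mult_linears:
  "swap (mult_linears N cs F) = mult_linears N (map prod.swap cs) (swap F)"
proof (induction cs arbitrary: F)
  case Nil
  then show ?case by (simp add: mult_linears_def)
next
  case (Cons c cs)
  obtain \<gamma> \<delta> where c: "c = (\<gamma>, \<delta>)" by fastforce
  show ?case by (simp add: c mult_linears_Cons Cons.IH swap_mult_linear_funpow)
qed

section \<open>Clearing denominators in a restricted series\<close>

text \<open>
  At the lowest exponents of the variables in \<open>S\<close>, these variables act as \<open>0\<close>. What remains of a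
  difference of sums of variables is the linear form in the two variables of the slice.
\<close>

lemma slice_mult_diff:
  assumes H: "vanishes_below S n H"
    and "finite E" "finite E'" "E \<subseteq> {e, e'} \<union> S" "E' \<subseteq> {e, e'} \<union> S"
    and ne: "e \<noteq> e'" "e \<notin> S" "e' \<notin> S"
  shows "slice e e' n (mult_diff E E' H) =
    mult_linear (of_bool (e \<in> E) - of_bool (e \<in> E')) (of_bool (e' \<in> E) - of_bool (e' \<in> E'))
      (slice e e' n H)"
proof (intro ext)
  fix i j
  let ?k = "n(e := i, e' := j)"
  have *: "(\<Sum>d\<in>A. H (?k(d := ?k d - 1))) =
      of_bool (e \<in> A) *s slice e e' n H (i - 1) j + of_bool (e' \<in> A) *s slice e e' n H i (j - 1)"
    if A: "finite A" "A \<subseteq> {e, e'} \<union> S" for A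
  proof -
    have z: "H (?k(d := ?k d - 1)) = 0" if "d \<in> A - {e, e'}" for d
    proof -
      have "d \<in> S" "(?k(d := ?k d - 1)) d < n d" using that A by auto
      then show ?thesis using H unfolding vanishes_below_def by blast
    qed
    have "(\<Sum>d\<in>A. H (?k(d := ?k d - 1))) = (\<Sum>d\<in>A \<inter> {e, e'}. H (?k(d := ?k d - 1)))"
      using A z by (intro sum.mono_neutral_right) auto
    also have "\<dots> = (\<Sum>d\<in>{e, e'}. of_bool (d \<in> A) *s H (?k(d := ?k d - 1)))"
      by (rule sum.mono_neutral_cong_left) auto
    also have "\<dots> = of_bool (e \<in> A) *s slice e e' n H (i - 1) j +
        of_bool (e' \<in> A) *s slice e e' n H i (j - 1)"
      using ne by (simp add: slice_def fun_upd_twist)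
    finally show ?thesis .
  qed
  show "slice e e' n (mult_diff E E' H) i j = mult_linear (of_bool (e \<in> E) - of_bool (e \<in> E'))
      (of_bool (e' \<in> E) - of_bool (e' \<in> E')) (slice e e' n H) i j"
    unfolding mult_linear_def scale_left_diff_distrib
    by (subst slice_def, subst mult_diff_def) (simp only: * assms algebra_simps)
qed

lemma slice_mult_diff_funpow:
  assumes "vanishes_below S n H"
    and "finite E" "finite E'" "E \<subseteq> {e, e'} \<union> S" "E' \<subseteq> {e, e'} \<union> S"
    and "e \<noteq> e'" "e \<notin> S" "e' \<notin> S"
  shows "slice e e' n ((mult_diff E E' ^^ N) H) =
    (mult_linear (of_bool (e \<in> E) - of_bool (e \<in> E')) (of_bool (e' \<in> E) - of_bool (e' \<in> E')) ^^ N)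
      (slice e e' n H)"
proof (induction N)
  case (Suc N)
  have "slice e e' n ((mult_diff E E' ^^ Suc N) H) =
      slice e e' n (mult_diff E E' ((mult_diff E E' ^^ N) H))"
    by simp
  also have "\<dots> = mult_linear (of_bool (e \<in> E) - of_bool (e \<in> E'))
      (of_bool (e' \<in> E) - of_bool (e' \<in> E')) (slice e e' n ((mult_diff E E' ^^ N) H))"
    by (rule slice_mult_diff[OF vanishes_below_mult_diff_funpow]) (fact assms)+
  finally show ?case unfolding Suc.IH by (simp only: funpow.simps comp_def)
qed simp

text \<open>
  The coefficients of \<open>s\<^sub>i - s\<^sub>j\<close>, for \<open>i \<noteq> j\<close>, in the variables of \<open>e\<close> and \<open>e'\<close>, in the order in which
  \<open>clear_denoms\<close> runs through the pairs.
\<close>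

definition slice_coeffs ::
    "addr \<Rightarrow> addr \<Rightarrow> nat \<Rightarrow> (nat \<Rightarrow> addr set) \<Rightarrow> (complex \<times> complex) list" where
  "slice_coeffs e e' r s = map (\<lambda>(i, j).
       (of_bool (e \<in> s i) - of_bool (e \<in> s j), of_bool (e' \<in> s i) - of_bool (e' \<in> s j)))
     [(i, j). i \<leftarrow> [0..<r], j \<leftarrow> [0..<r], i \<noteq> j]"

lemma slice_clear_denoms:
  assumes "vanishes_below S n H"
    and s: "\<And>i. i < r \<Longrightarrow> finite (s i) \<and> s i \<subseteq> {e, e'} \<union> S"
    and ne: "e \<noteq> e'" "e \<notin> S" "e' \<notin> S"
  shows "slice e e' n (clear_denoms r s N H) =
    mult_linears N (slice_coeffs e e' r s) (slice e e' n H)"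
proof -
  have "slice e e' n (fold (\<lambda>(i, j). mult_diff (s i) (s j) ^^ N) ps H) =
      mult_linears N (map (\<lambda>(i, j). (of_bool (e \<in> s i) - of_bool (e \<in> s j),
        of_bool (e' \<in> s i) - of_bool (e' \<in> s j))) ps) (slice e e' n H)"
    if "\<forall>(i, j)\<in>set ps. i < r \<and> j < r" "vanishes_below S n H" for ps H
    using that
  proof (induction ps arbitrary: H)
    case Nil
    then show ?case by (simp add: mult_linears_def)
  next
    case (Cons p ps)
    obtain i j where p: "p = (i, j)" by fastforce
    have ij: "i < r" "j < r" using Cons.prems p by auto
    let ?H = "(mult_diff (s i) (s j) ^^ N) H"
    have "slice e e' n ?H = (mult_linear (of_bool (e \<in> s i) - of_bool (e \<in> s j))
        (of_bool (e' \<in> s i) - of_bool (e' \<in> s j)) ^^ N) (slice e e' n H)"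
      using Cons.prems(2) s ij ne by (intro slice_mult_diff_funpow) auto
    moreover have "vanishes_below S n ?H"
      by (intro vanishes_below_mult_diff_funpow Cons.prems)
    ultimately show ?case
      using Cons.IH[of ?H] Cons.prems(1) by (simp add: p mult_linears_Cons del: of_bool_eq_iff)
  qed
  from this[OF _ assms(1)] show ?thesis
    unfolding clear_denoms_def slice_coeffs_def by auto
qed

lemma mult_linear_difference: "mult_linear 1 (-1) = mult_x_minus_y"
  by (simp add: mult_linear_def mult_x_minus_y_def fun_eq_iff)

lemma mult_x_minus_y_funpow_diff:
  "(mult_x_minus_y ^^ N) (\<lambda>m n. F m n - G m n) =
   (\<lambda>m n. (mult_x_minus_y ^^ N) F m n - (mult_x_minus_y ^^ N) G m n)"
proof (induction N)
  case (Suc N)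
  show ?case unfolding funpow.simps comp_def Suc.IH
    by (subst (1 2 3) mult_x_minus_y_def) (simp add: algebra_simps)
qed simp

lemma mult_linear_funpow_eq_zero:
  assumes "(mult_linear \<alpha> \<beta> ^^ N) F = (\<lambda>i j. 0)" "bounded_snd F" "\<alpha> \<noteq> 0 \<or> \<beta> \<noteq> 0"
  shows "F = (\<lambda>i j. 0)"
proof (rule mult_linear_funpow_cancel[OF assms(2) _ assms(3)])
  have "(mult_linear \<alpha> \<beta> ^^ N) (\<lambda>i j. 0) = (\<lambda>i j. 0)"
  proof (induction N)
    case (Suc N)
    show ?case unfolding funpow.simps comp_def Suc.IH by (simp add: mult_linear_def)
  qed simp
  then show "(mult_linear \<alpha> \<beta> ^^ N) F = (mult_linear \<alpha> \<beta> ^^ N) (\<lambda>i j. 0)"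
    using assms(1) by simp
qed (simp add: bounded_snd_def)

text \<open>
  The three factors that occur when the variables of a flat tree with at most three leaves are
  introduced one after the other, the last of them lying in \<open>S\<close>.
\<close>

lemma slice_mult_diff_pairs:
  assumes "vanishes_below S n H" "e \<noteq> e'" "e \<notin> S" "e' \<notin> S"
  shows "slice e e' n ((mult_diff {e} {e'} ^^ N) H) = (mult_linear 1 (-1) ^^ N) (slice e e' n H)"
    and "d \<in> S \<Longrightarrow> slice e e' n ((mult_diff {e} {d} ^^ N) H) = (mult_linear 1 0 ^^ N) (slice e e' n H)"
    and "d \<in> S \<Longrightarrow> slice e e' n ((mult_diff {e'} {d} ^^ N) H) = (mult_linear 0 1 ^^ N) (slice e e' n H)"
proof -
  have "d \<noteq> e" "d \<noteq> e'" if "d \<in> S" using assms that by auto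
  then show "slice e e' n ((mult_diff {e} {e'} ^^ N) H) = (mult_linear 1 (-1) ^^ N) (slice e e' n H)"
    and "d \<in> S \<Longrightarrow> slice e e' n ((mult_diff {e} {d} ^^ N) H) = (mult_linear 1 0 ^^ N) (slice e e' n H)"
    and "d \<in> S \<Longrightarrow> slice e e' n ((mult_diff {e'} {d} ^^ N) H) = (mult_linear 0 1 ^^ N) (slice e e' n H)"
    using assms by (subst slice_mult_diff_funpow[OF assms(1)]; auto)+
qed

end

section \<open>Trees with at most three leaves\<close>

lemma vertices_Leaf: "vertices Leaf = {[]}"
proof -
  have "sub_at Leaf v \<noteq> None \<longleftrightarrow> v = []" for v by (cases v) auto
  then show ?thesis by (auto simp: vertices_def)
qed

lemma vertices_Node: "vertices (Node ts) = insert [] (\<Union>i<length ts. (#) i ` vertices (ts ! i))"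
proof -
  have "sub_at (Node ts) v \<noteq> None \<longleftrightarrow>
      v = [] \<or> (\<exists>i w. v = i # w \<and> i < length ts \<and> sub_at (ts ! i) w \<noteq> None)" for v
    by (cases v) auto
  then show ?thesis by (auto simp: vertices_def)
qed

lemma leaves_Leaf: "leaves Leaf = {[]}"
proof -
  have "sub_at Leaf v = Some Leaf \<longleftrightarrow> v = []" for v by (cases v) auto
  then show ?thesis by (auto simp: leaves_def)
qed

lemma leaves_Node: "leaves (Node ts) = (\<Union>i<length ts. (#) i ` leaves (ts ! i))"
proof -
  have "sub_at (Node ts) v = Some Leaf \<longleftrightarrow>
      (\<exists>i w. v = i # w \<and> i < length ts \<and> sub_at (ts ! i) w = Some Leaf)" for v
    by (cases v) auto
  then show ?thesis by (auto simp: leaves_def)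
qed

lemmas tree_simps = vertices_Leaf vertices_Node leaves_Leaf leaves_Node lessThan_Suc

abbreviation flat1 :: ptree where "flat1 \<equiv> Node [Leaf]"
abbreviation flat2 :: ptree where "flat2 \<equiv> Node [Leaf, Leaf]"
abbreviation flat3 :: ptree where "flat3 \<equiv> Node [Leaf, Leaf, Leaf]"
abbreviation comb :: ptree where "comb \<equiv> Node [Leaf, flat2]"

lemma is_tree_simps: "is_tree (Node [])" "is_tree Leaf" "is_tree flat1" "is_tree flat2"
  "is_tree flat3" "is_tree comb"
  by (simp_all add: is_tree_def)

lemma edges_simps: "edges (Node []) = {}" "edges flat1 = {[0]}" "edges flat2 = {[0], [1]}"
  "edges flat3 = {[0], [1], [2]}" "edges comb = {[0], [1], [1, 0], [1, 1]}"
  by (auto simp: edges_def tree_simps)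

lemma leaves_simps: "leaves (Node []) = {}" "leaves flat1 = {[0]}" "leaves flat2 = {[0], [1]}"
  "leaves flat3 = {[0], [1], [2]}" "leaves comb = {[0], [1, 0], [1, 1]}"
  by (auto simp: tree_simps)

lemma internals_simps: "internals (Node []) = {[]}" "internals flat1 = {[]}"
  "internals flat2 = {[]}" "internals flat3 = {[]}"
  by (auto simp: internals_def tree_simps)

lemma incoming_simps: "incoming (Node []) [] = {}" "incoming flat1 [] = {[0]}"
  "incoming flat2 [] = {[0], [1]}" "incoming flat3 [] = {[0], [1], [2]}"
  "incoming comb [] = {[0], [1]}" "incoming comb [1] = {[1, 0], [1, 1]}"
  by (auto simp: incoming_def tree_simps)

lemma surviving_edges_comb: "surviving_edges comb = edges comb"
  by (auto simp: surviving_edges_def edges_simps)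

definition inputs2 :: "'b \<Rightarrow> 'b \<Rightarrow> addr \<Rightarrow> 'b" where
  "inputs2 a b = (\<lambda>l. if l = [0] then a else b)"

definition inputs3 :: "'b \<Rightarrow> 'b \<Rightarrow> 'b \<Rightarrow> addr \<Rightarrow> 'b" where
  "inputs3 a b c = (\<lambda>l. if l = [0] then a else if l = [1] then b else c)"

lemma upt_2_3: "[0..<2] = [0, 1]" "[0..<3] = [0, 1, 2]"
  by (simp_all add: upt_rec)

lemma f2_at_y_zero_eq:
  "f2_at_y_zero f a b n = f flat2 (inputs2 a b) (\<lambda>e. if e = [0] then n else 0)"
  by (simp add: f2_at_y_zero_def inputs2_def)

lemma supp_subset_iff: "supp n \<subseteq> E \<longleftrightarrow> (\<forall>e. e \<notin> E \<longrightarrow> n e = 0)"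
  unfolding supp_def by blast

section \<open>Vacuum and translation axioms\<close>

context relaxed_algebra
begin

lemma f_cong: "is_tree p \<Longrightarrow> (\<And>l. l \<in> leaves p \<Longrightarrow> a l = a' l) \<Longrightarrow> f p a = f p a'"
  using multi[of p] unfolding Multi_def by blast

lemma f_supp: "is_tree p \<Longrightarrow> f p a n \<noteq> 0 \<Longrightarrow> supp n \<subseteq> edges p"
  using multi[of p] unfolding Multi_def by blast

lemma f_linear:
  "is_tree p \<Longrightarrow> l \<in> leaves p \<Longrightarrow> Vector_Spaces.linear scale scale (\<lambda>c. f p (a(l := c)) n)"
  using multi[of p] unfolding Multi_def by blast

lemma f_T_compatible: "is_tree p \<Longrightarrow> T_compatible p (f p)"
  using multi[of p] unfolding Multi_def by blast

lemma f_expanded: "is_tree p \<Longrightarrow> expanded p (f p a)"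
  using multi[of p] unfolding Multi_def by blast

lemma f_Ord: "is_tree p \<Longrightarrow> total_order_of p t \<Longrightarrow> Ord p t (f p)"
  using multi[of p] unfolding Multi_def by blast

lemma f_Sing_flat:
  assumes "is_tree p" "internals p = {[]}"
  shows "Sing p [] (root_series p) (f p)"
proof -
  have "total_order_of p [[]]" using assms(2) by (simp add: total_order_of_def)
  from f_Ord[OF assms(1) this] show ?thesis by (simp add: Ord_def)
qed

lemma f_sing_stages:
  assumes "is_tree p" "internals p = {[]}"
  shows "sing_stages p [] (map (\<lambda>i. [i]) [0..<card (incoming p [])]) (root_series p) (f p)"
proof -
  have "id permutes {..<card (incoming p [])} \<and> evenperm id"
    by (simp add: permutes_id evenperm_id)
  with f_Sing_flat[OF assms] have "sing_stages p []
      (map (\<lambda>i. [] @ [id i]) [0..<card (incoming p [])]) (root_series p) (f p)"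
    unfolding Sing_def by blast
  then show ?thesis by simp
qed

lemma linear_left: "Vector_Spaces.linear scale scale (\<lambda>a. f flat2 (inputs2 a b) n)"
proof -
  have "f flat2 (inputs2 a b) = f flat2 ((inputs2 0 b)([0] := a))" for a
    by (rule f_cong) (auto simp: is_tree_simps leaves_simps inputs2_def)
  then show ?thesis using f_linear[of flat2 "[0]" "inputs2 0 b" n]
    by (simp add: is_tree_simps leaves_simps)
qed

lemma linear_right: "Vector_Spaces.linear scale scale (\<lambda>b. f flat2 (inputs2 a b) n)"
proof -
  have "f flat2 (inputs2 a b) = f flat2 ((inputs2 a 0)([1] := b))" for b
    by (rule f_cong) (auto simp: is_tree_simps leaves_simps inputs2_def)
  then show ?thesis using f_linear[of flat2 "[1]" "inputs2 a 0" n]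
    by (simp add: is_tree_simps leaves_simps)
qed

lemma f2_zero_right: "f flat2 (inputs2 a 0) n = 0"
proof -
  interpret R: Vector_Spaces.linear scale scale "\<lambda>b. f flat2 (inputs2 a b) n"
    by (rule linear_right)
  show ?thesis by (rule R.zero)
qed

lemma f_Leaf: "(\<And>e. n e = 0) \<Longrightarrow> f Leaf a n = a []"
proof -
  assume "\<And>e. n e = 0"
  then have "n = (\<lambda>e. 0)" by blast
  then show ?thesis by (simp add: identity)
qed

text \<open>
  The composite \<open>f\<^sub>2(a, f\<^sub>2(b, c))\<close>, which is the iterated vertex operator once the variables \<open>[1]\<close> and
  \<open>[1, 1]\<close> are set to \<open>0\<close>.
\<close>

lemma f_comb:
  assumes n: "supp n \<subseteq> edges comb"
  shows "f comb a n = f flat2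
     (inputs2 (a [0]) (f flat2 (inputs2 (a [1, 0]) (a [1, 1]))
        (\<lambda>e. if e = [] then 0 else n (1 # e))))
     (\<lambda>e. if e \<in> {[0], [1]} then n e else 0)"
proof -
  let ?ps = "\<lambda>l::addr. if l = [0] then Leaf else flat2"
  have g: "graft flat2 ?ps = comb" by simp
  have p: "prune comb = comb" by simp
  have u: "unprune_addr comb v = v" if "v \<in> leaves comb \<union> edges comb" for v
    using that by (auto simp: leaves_simps edges_simps)
  have n0: "n e = 0" if "e \<notin> edges comb" for e using n that by (auto simp: supp_def)
  have "unprune comb (f comb) a n = f comb (\<lambda>v. a (unprune_addr comb v))
      (\<lambda>e. if e \<in> edges comb then n (unprune_addr comb e) else 0)"
    using n by (simp only: unprune_def surviving_edges_comb p if_True)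
  also have "(\<lambda>e. if e \<in> edges comb then n (unprune_addr comb e) else 0) = n"
    using u n0 by (auto simp: fun_eq_iff)
  also have "f comb (\<lambda>v. a (unprune_addr comb v)) = f comb a"
    by (rule f_cong) (simp_all add: is_tree_simps u)
  finally have "f comb a n = compose flat2 (f flat2) (\<lambda>l. f (?ps l)) a n"
    using composition[of flat2 ?ps n a] n unfolding g p by (simp add: is_tree_simps)
  also have "\<dots> = f flat2
     (inputs2 (a [0]) (f flat2 (inputs2 (a [1, 0]) (a [1, 1]))
        (\<lambda>e. if e = [] then 0 else n (1 # e))))
     (\<lambda>e. if e \<in> {[0], [1]} then n e else 0)"
  proof -
    have "f Leaf (\<lambda>u. a ([0] @ u)) (\<lambda>u. if u = [] then 0 else n ([0] @ u)) = a [0]"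
      by (subst f_Leaf) (auto simp: n0 edges_simps)
    moreover have "f flat2 (\<lambda>u. a ([1] @ u)) = f flat2 (inputs2 (a [1, 0]) (a [1, 1]))"
      by (rule f_cong) (auto simp: is_tree_simps leaves_simps inputs2_def)
    moreover have "(\<lambda>u. if u = [] then 0 else n ([1] @ u)) =
        (\<lambda>e. if e = [] then 0 else n (1 # e))"
      by (simp add: fun_eq_iff)
    ultimately show ?thesis
      unfolding compose_def edges_simps
      by (intro fun_cong[OF f_cong])
        (auto simp: is_tree_simps leaves_simps inputs2_def simp del: One_nat_def)
  qed
  finally show ?thesis .
qed

lemma f_bounded:
  assumes "is_tree p" "v @ [i] \<in> edges p"
  obtains b where "\<And>m. (\<And>e. e \<notin> {v @ [j] | j. j \<le> i} \<Longrightarrow> m e = n e) \<Longrightarrow> m (v @ [i]) < b \<Longrightarrow> f p a m = 0"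
proof -
  obtain b where b: "\<forall>m. (\<forall>e. e \<notin> {v @ [j] | j. j \<le> i} \<longrightarrow> m e = n e) \<longrightarrow> f p a m \<noteq> 0 \<longrightarrow> b \<le> m (v @ [i])"
    using f_expanded[OF assms(1)] assms(2) unfolding expanded_def by blast
  show thesis
  proof (rule that[of b])
    fix m assume "\<And>e. e \<notin> {v @ [j] | j. j \<le> i} \<Longrightarrow> m e = n e" "m (v @ [i]) < b"
    with b show "f p a m = 0" by (meson leD)
  qed
qed

text \<open>
  In the chosen expansion, fixing the exponents of all variables but the first one leaves a Laurent
  series.
\<close>

lemma field_Laurent: "\<exists>b. \<forall>n<b. f2_at_y_zero f a c n = 0"
proof -
  obtain b where b: "\<And>m. (\<And>e. e \<notin> {[] @ [j] | j. j \<le> 0} \<Longrightarrow> m e = 0) \<Longrightarrow> m ([] @ [0]) < b \<Longrightarrow>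
      f flat2 (inputs2 a c) m = 0"
    by (rule f_bounded[of flat2 "[]" 0 "\<lambda>_. 0" "inputs2 a c"]) (auto simp: is_tree_simps edges_simps)
  have "f flat2 (inputs2 a c) (\<lambda>e. if e = [0] then n else 0) = 0" if "n < b" for n
    by (rule b) (use that in auto)
  then show ?thesis unfolding f2_at_y_zero_eq by blast
qed

lemma field_linear_left: "Vector_Spaces.linear scale scale (\<lambda>a. f2_at_y_zero f a b n)"
  using linear_left unfolding f2_at_y_zero_eq .

lemma field_linear_right: "Vector_Spaces.linear scale scale (\<lambda>b. f2_at_y_zero f a b n)"
  using linear_right unfolding f2_at_y_zero_eq .

text \<open>
  \<open>T f\<^sub>2(a, b) = (\<partial>\<^sub>x + \<partial>\<^sub>y) f\<^sub>2(a, b)\<close> and \<open>\<partial>\<^sub>y f\<^sub>2(a, b) = f\<^sub>2(a, T b)\<close>, compared at \<open>x\<^sup>n y\<^sup>0\<close>.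
\<close>

lemma field_translation:
  "T (f2_at_y_zero f a b n) - f2_at_y_zero f a (T b) n = of_int (n + 1) *s f2_at_y_zero f a b (n + 1)"
proof -
  let ?n = "\<lambda>e. if e = [0] then n else 0"
  let ?F = "f flat2 (inputs2 a b)"
  have T: "T_compatible flat2 (f flat2)" by (simp add: f_T_compatible is_tree_simps)
  have "f flat2 ((inputs2 a b)([1] := T (inputs2 a b [1]))) = deriv_var [1] ?F"
    using T unfolding T_compatible_def leaves_simps T_below_def by simp
  moreover have "f flat2 ((inputs2 a b)([1] := T (inputs2 a b [1]))) = f flat2 (inputs2 a (T b))"
    by (rule f_cong) (auto simp: is_tree_simps leaves_simps inputs2_def)
  ultimately have y: "f flat2 (inputs2 a (T b)) ?n = deriv_var [1] ?F ?n" by simp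
  have "(\<Sum>e\<in>{[0], [1]}. deriv_var e ?F ?n) = T (?F ?n)"
    using T unfolding T_compatible_def internals_simps T_below_def incoming_simps(3)[symmetric] by simp
  then have "T (?F ?n) - f flat2 (inputs2 a (T b)) ?n = deriv_var [0] ?F ?n"
    unfolding y by (simp add: algebra_simps)
  also have "\<dots> = of_int (n + 1) *s ?F (\<lambda>e. if e = [0] then n + 1 else 0)"
    unfolding deriv_var_def by (simp add: fun_upd_def cong: if_cong)
  finally show ?thesis unfolding f2_at_y_zero_eq .
qed

text \<open>
  At the root of the empty tree, invariance equates the empty sum of derivatives with the action of
  \<open>T\<close> on the value.
\<close>

lemma T_vacuum: "T (vacuum_vector f) = 0"
  using f_T_compatible[of "Node []"]
  unfolding T_compatible_def internals_simps incoming_simps T_below_def vacuum_vector_def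
  by (simp add: is_tree_simps incoming_simps)

lemma f_empty: "(\<And>e. n e = 0) \<Longrightarrow> f (Node []) a n = vacuum_vector f"
proof -
  assume "\<And>e. n e = 0"
  then have "n = (\<lambda>e. 0)" by blast
  moreover have "f (Node []) a = f (Node []) (\<lambda>_. 0)"
    by (rule f_cong) (simp_all add: is_tree_simps leaves_simps)
  ultimately show ?thesis by (simp add: vacuum_vector_def)
qed

lemma f_flat1_const: "f flat1 a ((\<lambda>_. 0)([0] := 0)) = a [0]"
proof -
  have n: "(\<lambda>_. 0 :: int)([0] := 0) = (\<lambda>e. if e = [0] then int 0 else 0)"
    by (auto simp: fun_eq_iff)
  have "f flat1 a (\<lambda>e. if e = [0] then int 0 else 0) = (1 / fact 0) *s (T ^^ 0) (f Leaf (\<lambda>u. a [0]) (\<lambda>e. 0))"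
    using refinement_vertex_edge unfolding refines_vertex_edge_def by blast
  then show ?thesis unfolding n by (simp add: identity)
qed

lemma f_flat1_negative: "n [0] < 0 \<Longrightarrow> f flat1 a n = 0"
proof -
  assume n: "n [0] < 0"
  have "sing_stages flat1 [] [[0]] (root_series flat1) (f flat1)"
    using f_sing_stages[of flat1] by (simp add: is_tree_simps internals_simps incoming_simps)
  then have "\<forall>c. root_series flat1 (\<lambda>a. feed flat1 [0] c (\<lambda>_. 0) (f flat1) a)"
    by simp
  then have "root_series flat1 (\<lambda>a'. feed flat1 [0] (a [0]) (\<lambda>_. 0) (f flat1) a')" by blast
  then have "feed flat1 [0] (a [0]) (\<lambda>_. 0) (f flat1) a n = 0"
    unfolding root_series_def using n by (auto simp: incoming_simps)
  then show ?thesis by (simp add: feed_def leaves_simps)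
qed

text \<open>
  Gluing the empty tree to a leaf removes the edge of that leaf, so the composite does not depend
  on the corresponding variable and is given by the one-leafed tree in the other one.
\<close>

lemma f2_vacuum_left:
  assumes "supp n \<subseteq> {[0], [1]}"
  shows "f flat2 (inputs2 (vacuum_vector f) a) n =
    (if n [0] = 0 then f flat1 (\<lambda>_. a) ((\<lambda>_. 0)([0] := n [1])) else 0)"
proof -
  let ?ps = "\<lambda>l::addr. if l = [0] then Node [] else Leaf"
  let ?g = "Node [Node [], Leaf]"
  have g: "graft flat2 ?ps = ?g" by simp
  have p: "prune ?g = flat1" by simp
  have e: "edges ?g = {[0], [1]}" by (auto simp: edges_def tree_simps)
  have s: "surviving_edges ?g = {[1]}" by (auto simp: surviving_edges_def e)
  have n0: "n e = 0" if "e \<noteq> [0]" "e \<noteq> [1]" for e using assms that by (auto simp: supp_def)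
  have not01: "[0] \<noteq> [1 :: nat]" by simp
  have "compose flat2 (f flat2) (\<lambda>l. f (?ps l)) (\<lambda>_. a) n = f flat2 (inputs2 (vacuum_vector f) a) n"
  proof -
    have n: "(\<lambda>e. if e \<in> edges flat2 then n e else 0) = n"
      using n0 by (auto simp: edges_simps fun_eq_iff)
    have "f (Node []) (\<lambda>u. a) (\<lambda>u. if u = [] then 0 else n ([0] @ u)) = vacuum_vector f"
      "f Leaf (\<lambda>u. a) (\<lambda>u. if u = [] then 0 else n ([1] @ u)) = a"
      by (subst f_empty f_Leaf; simp add: n0)+
    then have "f flat2 (\<lambda>l. f (?ps l) (\<lambda>u. a) (\<lambda>u. if u = [] then 0 else n (l @ u))) =
        f flat2 (inputs2 (vacuum_vector f) a)"
      by (intro f_cong) (auto simp: is_tree_simps leaves_simps inputs2_def simp del: One_nat_def)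
    with n show ?thesis unfolding compose_def by (simp only:)
  qed
  moreover have "unprune ?g (f flat1) (\<lambda>_. a) n =
      compose flat2 (f flat2) (\<lambda>l. f (?ps l)) (\<lambda>_. a) n"
    using composition[of flat2 ?ps n "\<lambda>_. a"] assms unfolding g p e by (simp add: is_tree_simps)
  moreover have "unprune ?g (f flat1) (\<lambda>_. a) n =
      (if n [0] = 0 then f flat1 (\<lambda>_. a) ((\<lambda>_. 0)([0] := n [1])) else 0)"
  proof -
    have "supp n \<subseteq> {[1]} \<longleftrightarrow> n [0] = 0"
      using n0 not01 unfolding supp_subset_iff by (metis singleton_iff)
    moreover have "(\<lambda>e. if e \<in> edges flat1 then n (unprune_addr ?g e) else 0) = (\<lambda>_. 0)([0] := n [1])"
      by (auto simp: edges_simps fun_eq_iff)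
    ultimately show ?thesis unfolding unprune_def s p by simp
  qed
  ultimately show ?thesis by simp
qed

lemma f2_vacuum_right:
  assumes "supp n \<subseteq> {[0], [1]}"
  shows "f flat2 (inputs2 a (vacuum_vector f)) n =
    (if n [1] = 0 then f flat1 (\<lambda>_. a) ((\<lambda>_. 0)([0] := n [0])) else 0)"
proof -
  let ?ps = "\<lambda>l::addr. if l = [0] then Leaf else Node []"
  let ?g = "Node [Leaf, Node []]"
  have g: "graft flat2 ?ps = ?g" by simp
  have p: "prune ?g = flat1" by simp
  have e: "edges ?g = {[0], [1]}" by (auto simp: edges_def tree_simps)
  have s: "surviving_edges ?g = {[0]}" by (auto simp: surviving_edges_def e)
  have n0: "n e = 0" if "e \<noteq> [0]" "e \<noteq> [1]" for e using assms that by (auto simp: supp_def)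
  have not01: "[0] \<noteq> [1 :: nat]" by simp
  have "compose flat2 (f flat2) (\<lambda>l. f (?ps l)) (\<lambda>_. a) n = f flat2 (inputs2 a (vacuum_vector f)) n"
  proof -
    have n: "(\<lambda>e. if e \<in> edges flat2 then n e else 0) = n"
      using n0 by (auto simp: edges_simps fun_eq_iff)
    have "f (Node []) (\<lambda>u. a) (\<lambda>u. if u = [] then 0 else n ([1] @ u)) = vacuum_vector f"
      "f Leaf (\<lambda>u. a) (\<lambda>u. if u = [] then 0 else n ([0] @ u)) = a"
      by (subst f_empty f_Leaf; simp add: n0)+
    then have "f flat2 (\<lambda>l. f (?ps l) (\<lambda>u. a) (\<lambda>u. if u = [] then 0 else n (l @ u))) =
        f flat2 (inputs2 a (vacuum_vector f))"
      by (intro f_cong) (auto simp: is_tree_simps leaves_simps inputs2_def simp del: One_nat_def)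
    with n show ?thesis unfolding compose_def by (simp only:)
  qed
  moreover have "unprune ?g (f flat1) (\<lambda>_. a) n =
      compose flat2 (f flat2) (\<lambda>l. f (?ps l)) (\<lambda>_. a) n"
    using composition[of flat2 ?ps n "\<lambda>_. a"] assms unfolding g p e by (simp add: is_tree_simps)
  moreover have "unprune ?g (f flat1) (\<lambda>_. a) n =
      (if n [1] = 0 then f flat1 (\<lambda>_. a) ((\<lambda>_. 0)([0] := n [0])) else 0)"
  proof -
    have "supp n \<subseteq> {[0]} \<longleftrightarrow> n [1] = 0"
      using n0 not01 unfolding supp_subset_iff by (metis singleton_iff)
    moreover have "(\<lambda>e. if e \<in> edges flat1 then n (unprune_addr ?g e) else 0) = (\<lambda>_. 0)([0] := n [0])"
      by (auto simp: edges_simps fun_eq_iff)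
    ultimately show ?thesis unfolding unprune_def s p by simp
  qed
  ultimately show ?thesis by simp
qed

lemma field_of_vacuum: "f2_at_y_zero f (vacuum_vector f) a n = (if n = 0 then a else 0)"
proof -
  have "f flat2 (inputs2 (vacuum_vector f) a) (\<lambda>e. if e = [0] then n else 0) =
      (if n = 0 then f flat1 (\<lambda>_. a) ((\<lambda>_. 0)([0] := 0)) else 0)"
    by (subst f2_vacuum_left) (auto simp: supp_def)
  then show ?thesis by (simp add: f2_at_y_zero_eq f_flat1_const del: fun_upd_triv)
qed

lemma field_at_vacuum:
  "f2_at_y_zero f a (vacuum_vector f) n = f flat1 (\<lambda>_. a) ((\<lambda>_. 0)([0] := n))"
proof -
  have "f flat2 (inputs2 a (vacuum_vector f)) (\<lambda>e. if e = [0] then n else 0) =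
      f flat1 (\<lambda>_. a) ((\<lambda>_. 0)([0] := n))"
    by (subst f2_vacuum_right) (auto simp: supp_def)
  then show ?thesis by (simp add: f2_at_y_zero_eq)
qed

section \<open>The three-point function at a vanishing last variable\<close>

lemma feed_leaf: "e \<in> leaves p \<Longrightarrow> feed p e c k F = (\<lambda>a. F (a(e := c)))"
  by (simp add: feed_def fun_eq_iff)

lemma f2_numerator:
  obtains N where "\<And>n. n [0] < 0 \<or> n [1] < 0 \<Longrightarrow>
    (mult_diff {[0]} {[1]} ^^ N) (f flat2 (inputs2 a b)) n = 0"
proof -
  have "sing_stages flat2 [] [[0], [1]] (root_series flat2) (f flat2)"
  proof -
    have "map (\<lambda>i. [i]) [0..<card (incoming flat2 [])] = [[0], [1]]"
      unfolding incoming_simps by (simp add: upt_2_3 card_insert_if)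
    then show ?thesis using f_sing_stages[of flat2] by (simp only: is_tree_simps internals_simps)
  qed
  then have "\<exists>N. root_series flat2 (\<lambda>z. (mult_diff {[0]} {[1]} ^^ N) (f flat2 (z([1] := b, [0] := a))))"
    by (simp add: feed_leaf leaves_simps del: One_nat_def)
  then obtain N where "root_series flat2 (\<lambda>z. (mult_diff {[0]} {[1]} ^^ N) (f flat2 (z([1] := b, [0] := a))))"
    by blast
  moreover have "f flat2 ((\<lambda>_. 0)([1] := b, [0] := a)) = f flat2 (inputs2 a b)"
    by (rule f_cong) (auto simp: is_tree_simps leaves_simps inputs2_def)
  ultimately show thesis
    by (intro that[of N]) (auto simp: root_series_def incoming_simps dest: spec[of _ "\<lambda>_. 0"])
qed

text \<open>
  The inputs are introduced in the order \<open>a\<close>, \<open>b\<close>, \<open>c\<close> (the stages for the identity permutation). The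
  exponent of \<open>x\<^sub>0 - x\<^sub>1\<close> is chosen as soon as \<open>a\<close> and \<open>b\<close> are known, hence before \<open>c\<close>.
\<close>

lemma f3_numerator:
  obtains N where "\<And>c. \<exists>M. \<forall>n. n [0] < 0 \<or> n [1] < 0 \<or> n [2] < 0 \<longrightarrow>
    (mult_diff {[1]} {[2]} ^^ M) ((mult_diff {[0]} {[2]} ^^ M)
      ((mult_diff {[0]} {[1]} ^^ N) (f flat3 (inputs3 a b c)))) n = 0"
proof -
  have "sing_stages flat3 [] [[0], [1], [2]] (root_series flat3) (f flat3)"
  proof -
    have "map (\<lambda>i. [i]) [0..<card (incoming flat3 [])] = [[0], [1], [2]]"
      unfolding incoming_simps by (simp add: upt_2_3 card_insert_if)
    then show ?thesis using f_sing_stages[of flat3] by (simp only: is_tree_simps internals_simps)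
  qed
  then obtain N where N: "\<And>c. \<exists>M. root_series flat3 (\<lambda>z. (mult_diff {[1]} {[2]} ^^ M) ((mult_diff {[0]} {[2]} ^^ M)
      ((mult_diff {[0]} {[1]} ^^ N) (f flat3 (z([2] := c, [1] := b, [0] := a))))))"
    by (simp add: feed_leaf leaves_simps del: One_nat_def) blast
  have *: "f flat3 ((\<lambda>_. 0)([2] := c, [1] := b, [0] := a)) = f flat3 (inputs3 a b c)" for c
    by (rule f_cong) (auto simp: is_tree_simps leaves_simps inputs3_def)
  show thesis
  proof (rule that[of N])
    fix c
    obtain M where "root_series flat3 (\<lambda>z. (mult_diff {[1]} {[2]} ^^ M) ((mult_diff {[0]} {[2]} ^^ M)
      ((mult_diff {[0]} {[1]} ^^ N) (f flat3 (z([2] := c, [1] := b, [0] := a))))))"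
      using N by blast
    then show "\<exists>M. \<forall>n. n [0] < 0 \<or> n [1] < 0 \<or> n [2] < 0 \<longrightarrow>
      (mult_diff {[1]} {[2]} ^^ M) ((mult_diff {[0]} {[2]} ^^ M)
        ((mult_diff {[0]} {[1]} ^^ N) (f flat3 (inputs3 a b c)))) n = 0"
      by (intro exI[of _ M]) (auto simp: root_series_def incoming_simps *[symmetric])
  qed
qed

text \<open>
  At a lowest negative power of \<open>y\<close>, the factor \<open>(x - y)\<^sup>N\<close> that makes \<open>f\<^sub>2\<close> a power series acts as \<open>x\<^sup>N\<close>.
  So the coefficient at this power vanishes. The edge \<open>[2]\<close> is not in the tree; it only serves as a
  second variable of the slice, and the series is constant in it.
\<close>

lemma f2_vanishes_below: "vanishes_below {[1]} (\<lambda>_. 0) (f flat2 (inputs2 a c))"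
proof -
  let ?F = "f flat2 (inputs2 a c)"
  have tree: "is_tree flat2" by (simp add: is_tree_simps)
  have supp: "k e = 0" if "?F k \<noteq> 0" "e \<noteq> [0]" "e \<noteq> [1]" for k e
    using f_supp[OF tree that(1)] that(2,3) unfolding edges_simps supp_subset_iff by blast
  obtain N where N: "\<And>n. n [0] < 0 \<or> n [1] < 0 \<Longrightarrow> (mult_diff {[0]} {[1]} ^^ N) ?F n = 0"
    using f2_numerator by blast
  show ?thesis
  proof (rule vanishes_below_zero[where e = "[0]" and e' = "[2]"])
    obtain b where b: "\<And>m. (\<And>e. e \<notin> {[] @ [j] | j. j \<le> 1} \<Longrightarrow> m e = 0) \<Longrightarrow> m ([] @ [1]) < b \<Longrightarrow> ?F m = 0"
      by (rule f_bounded[of flat2 "[]" 1 "\<lambda>_. 0" "inputs2 a c"]) (auto simp: is_tree_simps edges_simps)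
    have "?F k = 0" if "k [1] < b" for k
    proof (rule ccontr)
      assume nz: "?F k \<noteq> 0"
      have "?F k = 0"
        by (rule b) (use that in \<open>auto intro!: supp[OF nz]\<close>)
      with nz show False ..
    qed
    then show "\<exists>b. vanishes_below {[1]} ((\<lambda>_. 0)([1] := b)) ?F"
      by (auto simp: vanishes_below_def)
  next
    fix b :: int
    let ?n = "(\<lambda>_. 0)([1] := b)"
    assume "b < 0" "vanishes_below {[1]} ?n ?F"
    then have "(mult_linear 1 0 ^^ N) (slice [0] [2] ?n ?F) =
        slice [0] [2] ?n ((mult_diff {[0]} {[1]} ^^ N) ?F)"
      by (intro slice_mult_diff_pairs(2)[symmetric, where S = "{[1]}"]) auto
    also have "\<dots> = (\<lambda>i j. 0)"
      unfolding slice_def using \<open>b < 0\<close> by (intro ext N) auto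
    finally show "slice [0] [2] ?n ?F = (\<lambda>i j. 0)"
    proof (rule mult_linear_funpow_eq_zero)
      have "?F (?n([0] := i, [2] := j)) = 0" if "j < 0" for i j
        using supp[of "?n([0] := i, [2] := j)" "[2]"] that by auto
      then show "bounded_snd (slice [0] [2] ?n ?F)"
        by (intro bounded_sndI[of 0]) (simp add: slice_def)
    qed simp
  qed (use supp in auto)
qed

lemma slice_f3_numerator:
  assumes "vanishes_below {[2]} n H"
  shows "slice [0] [1] n ((mult_diff {[1]} {[2]} ^^ M) ((mult_diff {[0]} {[2]} ^^ M)
      ((mult_diff {[0]} {[1]} ^^ N) H))) =
    (mult_linear 0 1 ^^ M) ((mult_linear 1 0 ^^ M) ((mult_linear 1 (-1) ^^ N) (slice [0] [1] n H)))"
proof -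
  note pairs = slice_mult_diff_pairs[where S = "{[2]}" and e = "[0]" and e' = "[1]"]
  show ?thesis
    by (simp add: pairs assms vanishes_below_mult_diff_funpow del: One_nat_def)
qed

lemma bounded_slice_f3: "bounded_snd (slice [0] [1] n (f flat3 a))"
proof -
  obtain b where b: "\<And>m. (\<And>e. e \<notin> {[] @ [j] | j. j \<le> 1} \<Longrightarrow> m e = n e) \<Longrightarrow> m ([] @ [1]) < b \<Longrightarrow>
      f flat3 a m = 0"
    by (rule f_bounded[of flat3 "[]" 1 n a]) (auto simp: is_tree_simps edges_simps)
  have "f flat3 a (n([0] := i, [1] := j)) = 0" if "j < b" for i j
    by (rule b) (use that in auto)
  then show ?thesis by (intro bounded_sndI[of b]) (simp add: slice_def)
qed

text \<open>
  Likewise, at a lowest negative power of \<open>x\<^sub>2\<close> the denominators turn into \<open>(x\<^sub>0 - x\<^sub>1)\<^sup>N x\<^sub>0\<^sup>M x\<^sub>1\<^sup>M\<close>, which can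
  be cancelled because poles in \<open>x\<^sub>1\<close> are bounded for a fixed exponent of \<open>x\<^sub>2\<close>.
\<close>

lemma f3_vanishes_below: "vanishes_below {[2]} (\<lambda>_. 0) (f flat3 (inputs3 x y z))"
proof -
  let ?F = "f flat3 (inputs3 x y z)"
  have tree: "is_tree flat3" by (simp add: is_tree_simps)
  have supp: "k e = 0" if "?F k \<noteq> 0" "e \<noteq> [0]" "e \<noteq> [1]" "e \<noteq> [2]" for k e
    using f_supp[OF tree that(1)] that(2-) unfolding edges_simps supp_subset_iff by blast
  obtain N M where num: "\<And>n. n [0] < 0 \<or> n [1] < 0 \<or> n [2] < 0 \<Longrightarrow>
    (mult_diff {[1]} {[2]} ^^ M) ((mult_diff {[0]} {[2]} ^^ M)
      ((mult_diff {[0]} {[1]} ^^ N) ?F)) n = 0"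
    using f3_numerator[of x y] by metis
  show ?thesis
  proof (rule vanishes_below_zero[where e = "[0]" and e' = "[1]"])
    obtain b where b: "\<And>m. (\<And>e. e \<notin> {[] @ [j] | j. j \<le> 2} \<Longrightarrow> m e = 0) \<Longrightarrow> m ([] @ [2]) < b \<Longrightarrow> ?F m = 0"
      by (rule f_bounded[of flat3 "[]" 2 "\<lambda>_. 0" "inputs3 x y z"]) (auto simp: is_tree_simps edges_simps)
    have "?F k = 0" if "k [2] < b" for k
    proof (rule ccontr)
      assume nz: "?F k \<noteq> 0"
      have "?F k = 0"
        by (rule b) (use that in \<open>auto intro!: supp[OF nz]\<close>)
      with nz show False ..
    qed
    then show "\<exists>b. vanishes_below {[2]} ((\<lambda>_. 0)([2] := b)) ?F"
      by (auto simp: vanishes_below_def)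
  next
    fix b :: int
    let ?n = "(\<lambda>_. 0)([2] := b)" and ?L = "\<lambda>\<alpha> \<beta> N. mult_linear \<alpha> \<beta> ^^ N"
    assume "b < 0" "vanishes_below {[2]} ?n ?F"
    then have "?L 0 1 M (?L 1 0 M (?L 1 (-1) N (slice [0] [1] ?n ?F))) = 
        slice [0] [1] ?n ((mult_diff {[1]} {[2]} ^^ M) ((mult_diff {[0]} {[2]} ^^ M)
      ((mult_diff {[0]} {[1]} ^^ N) ?F)))"
      by (intro slice_f3_numerator[symmetric])
    also have "\<dots> = (\<lambda>i j. 0)"
      unfolding slice_def using \<open>b < 0\<close> by (intro ext num) auto
    finally have "?L 1 0 M (?L 1 (-1) N (slice [0] [1] ?n ?F)) = (\<lambda>i j. 0)"
      by (rule mult_linear_funpow_eq_zero)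
        (intro bounded_snd_mult_linear_funpow bounded_slice_f3, simp)
    then have "?L 1 (-1) N (slice [0] [1] ?n ?F) = (\<lambda>i j. 0)"
      by (rule mult_linear_funpow_eq_zero)
        (intro bounded_snd_mult_linear_funpow bounded_slice_f3, simp)
    then show "slice [0] [1] ?n ?F = (\<lambda>i j. 0)"
      by (rule mult_linear_funpow_eq_zero) (intro bounded_slice_f3, simp)
  qed (use supp in auto)
qed

text \<open>
  The expansion of \<open>f\<^sub>3(a, b, c)(x, z, 0)\<close> for \<open>|x| > |z|\<close>. By \<open>f3_vanishes_below\<close> the last variable may
  indeed be set to \<open>0\<close>.
\<close>

definition three_point :: "'b \<Rightarrow> 'b \<Rightarrow> 'b \<Rightarrow> int \<Rightarrow> int \<Rightarrow> 'b" where
  "three_point a b c = slice [0] [1] (\<lambda>_. 0) (f flat3 (inputs3 a b c))"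

text \<open>
  In \<open>f3_numerator\<close> only the exponents of \<open>x - w\<close> and \<open>z - w\<close> are chosen after \<open>c\<close>, and at \<open>w = 0\<close> these
  factors become the monomials \<open>x\<close> and \<open>z\<close>.
\<close>

lemma three_point_pole_uniform:
  "\<exists>N. \<forall>c. \<exists>M. \<forall>i j. i < 0 \<or> j < 0 \<longrightarrow>
    (mult_linear 0 1 ^^ M) ((mult_linear 1 0 ^^ M)
      ((mult_linear 1 (-1) ^^ N) (three_point a b c))) i j = 0"
proof -
  obtain N where N: "\<And>c. \<exists>M. \<forall>n. n [0] < 0 \<or> n [1] < 0 \<or> n [2] < 0 \<longrightarrow>
    (mult_diff {[1]} {[2]} ^^ M) ((mult_diff {[0]} {[2]} ^^ M)
      ((mult_diff {[0]} {[1]} ^^ N) (f flat3 (inputs3 a b c)))) n = 0"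
    using f3_numerator[of a b] by blast
  show ?thesis
  proof (rule exI[of _ N], rule allI)
    fix c
    obtain M where M: "\<And>n. n [0] < 0 \<or> n [1] < 0 \<or> n [2] < 0 \<Longrightarrow>
      (mult_diff {[1]} {[2]} ^^ M) ((mult_diff {[0]} {[2]} ^^ M)
      ((mult_diff {[0]} {[1]} ^^ N) (f flat3 (inputs3 a b c)))) n = 0"
      using N by blast
    show "\<exists>M. \<forall>i j. i < 0 \<or> j < 0 \<longrightarrow>
    (mult_linear 0 1 ^^ M) ((mult_linear 1 0 ^^ M)
      ((mult_linear 1 (-1) ^^ N) (three_point a b c))) i j = 0"
      unfolding three_point_def slice_f3_numerator[OF f3_vanishes_below, symmetric]
      by (intro exI[of _ M]) (auto simp: slice_def simp del: One_nat_def intro!: M)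
  qed
qed

end

section \<open>Locality\<close>

context commutative_relaxed_algebra
begin

text \<open>
  \<open>x - z\<close>, \<open>x - w\<close>, \<open>z - x\<close>, \<open>z - w\<close>, \<open>w - x\<close>, \<open>w - z\<close> at \<open>w = 0\<close>.
\<close>

abbreviation factors3 :: "(complex \<times> complex) list" where
  "factors3 \<equiv> [(1, -1), (1, 0), (-1, 1), (0, 1), (-1, 0), (0, -1)]"

lemma slice_coeffs_flat3:
  "slice_coeffs [0] [1] 3 (\<lambda>j. {[j]}) = factors3"
  by (simp add: slice_coeffs_def upt_2_3)

lemma bounded_three_point: "bounded_snd (three_point a b c)"
  unfolding three_point_def by (rule bounded_slice_f3)

lemma slice_flat3:
  "slice [0] [1] (\<lambda>_. 0) (clear_denoms 3 (\<lambda>j. {[j]}) N (f flat3 (inputs3 a b c))) =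
   mult_linears N factors3 (three_point a b c)"
proof -
  have "slice [0] [1] (\<lambda>_. 0) (clear_denoms 3 (\<lambda>j. {[j]}) N (f flat3 (inputs3 a b c))) =
      mult_linears N (slice_coeffs [0] [1] 3 (\<lambda>j. {[j]}))
        (slice [0] [1] (\<lambda>_. 0) (f flat3 (inputs3 a b c)))"
    by (rule slice_clear_denoms[OF f3_vanishes_below]) (auto simp: less_Suc_eq numeral_3_eq_3)
  then show ?thesis unfolding slice_coeffs_flat3 three_point_def .
qed

text \<open>
  Transposing the first two leaves exchanges \<open>a, x\<close> with \<open>b, z\<close>. The two sides are expansions in
  different domains, so only their numerators are comparable. The cleared denominator contains both
  \<open>x - z\<close> and \<open>z - x\<close>, so it is the same for both up to the order of its factors.
\<close>

lemma three_point_symmetric: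
  "\<exists>N. mult_linears N factors3 (three_point a b c) =
    mult_linears N factors3 (swap (three_point b a c))"
proof -
  let ?\<pi> = "Transposition.transpose 0 (1 :: nat)"
  let ?ts = "[Leaf, Leaf, Leaf]"
  let ?cs = factors3
  have len: "length ?ts = 3" by simp
  have "?\<pi> permutes {..<length ?ts}"
    by (rule permutes_swap_id) simp_all
  then have "permuted [] 3 ?\<pi> (f flat3)
      (f (replace_at flat3 [] (Node (map (\<lambda>j. ?ts ! ?\<pi> j) [0..<length ?ts]))))"
    unfolding len[symmetric] by (intro symmetric) (simp_all add: is_tree_simps)
  moreover have "replace_at flat3 [] (Node (map (\<lambda>j. ?ts ! ?\<pi> j) [0..<length ?ts])) = flat3"
    by (simp add: Transposition.transpose_def)
  ultimately have "permuted [] 3 ?\<pi> (f flat3) (f flat3)" by (simp only:)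
  then obtain N where "\<forall>n. (\<forall>e. e \<notin> {[] @ [j] | j. j < 3} \<longrightarrow> n e = (\<lambda>_. 0) e) \<longrightarrow>
      clear_denoms 3 (\<lambda>j. {[] @ [j]}) N (f flat3 (\<lambda>u. inputs3 a b c (perm_addr [] ?\<pi> u)))
        (\<lambda>e. n (perm_addr [] ?\<pi> e)) =
      clear_denoms 3 (\<lambda>j. {[] @ [j]}) N (f flat3 (inputs3 a b c)) n"
    unfolding permuted_def by (elim allE[of _ "inputs3 a b c"] allE[of _ "\<lambda>_. 0"]) blast
  then have N: "clear_denoms 3 (\<lambda>j. {[j]}) N (f flat3 (\<lambda>u. inputs3 a b c (perm_addr [] ?\<pi> u)))
        (\<lambda>e. n (perm_addr [] ?\<pi> e)) =
      clear_denoms 3 (\<lambda>j. {[j]}) N (f flat3 (inputs3 a b c)) n"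
    if "\<And>e. e \<notin> {[j] | j. j < 3} \<Longrightarrow> n e = 0" for n
    using that unfolding append_Nil by blast
  have pi: "perm_addr [] ?\<pi> e = perm_tail ?\<pi> e" for e
    by (simp add: perm_addr_def relocate_def)
  have inputs: "f flat3 (\<lambda>u. inputs3 a b c (perm_addr [] ?\<pi> u)) = f flat3 (inputs3 b a c)"
    unfolding pi
    by (rule f_cong) (auto simp: is_tree_simps leaves_simps inputs3_def Transposition.transpose_def)
  have exps: "(\<lambda>e. ((\<lambda>_. 0)([0] := i, [1] := j)) (perm_addr [] ?\<pi> e)) = (\<lambda>_. 0)([0] := j, [1] := i)"
    for i j :: int
  proof
    fix e
    show "((\<lambda>_. 0)([0] := i, [1] := j)) (perm_addr [] ?\<pi> e) = ((\<lambda>_. 0)([0] := j, [1] := i)) e"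
      unfolding pi by (cases e) (auto simp: Transposition.transpose_def)
  qed
  have "slice [0] [1] (\<lambda>_. 0) (clear_denoms 3 (\<lambda>j. {[j]}) N (f flat3 (inputs3 a b c))) =
      swap (slice [0] [1] (\<lambda>_. 0) (clear_denoms 3 (\<lambda>j. {[j]}) N (f flat3 (inputs3 b a c))))"
  proof (intro ext)
    fix i j
    have "clear_denoms 3 (\<lambda>j. {[j]}) N (f flat3 (inputs3 b a c)) ((\<lambda>_. 0)([0] := j, [1] := i)) =
      clear_denoms 3 (\<lambda>j. {[j]}) N (f flat3 (inputs3 a b c)) ((\<lambda>_. 0)([0] := i, [1] := j))"
      by (rule N[of "(\<lambda>_. 0)([0] := i, [1] := j)", unfolded exps inputs]) auto
    then show "slice [0] [1] (\<lambda>_. 0) (clear_denoms 3 (\<lambda>j. {[j]}) N (f flat3 (inputs3 a b c))) i j =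
      swap (slice [0] [1] (\<lambda>_. 0) (clear_denoms 3 (\<lambda>j. {[j]}) N (f flat3 (inputs3 b a c)))) i j"
      by (simp add: slice_def swap_def)
  qed
  then have "mult_linears N ?cs (three_point a b c) =
      mult_linears N (map prod.swap ?cs) (swap (three_point b a c))"
    unfolding slice_flat3 swap_mult_linears .
  moreover have "mult_linears N (map prod.swap ?cs) = mult_linears N ?cs"
    by (rule mult_linears_permute) simp
  ultimately show ?thesis by (intro exI[of _ N]) (simp only:)
qed

text \<open>
  At \<open>y = 0\<close> the substitution \<open>w\<^sub>k \<mapsto> z\<^sub>k + y\<close> is a mere renaming of variables.
\<close>

lemma subst_shrink_at_zero:
  assumes "k (v @ [i]) = 0" "\<And>j. j < m \<Longrightarrow> k (v @ [i, j]) \<ge> 0"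
  shows "subst_shrink v i m P k = P (\<lambda>e. k (shrink_addr v i m e))"
proof -
  have "{l. (\<forall>e. e \<notin> {v @ [i + j] | j. j < m} \<longrightarrow> l e = 0) \<and>
      (\<Sum>j<m. l (v @ [i + j])) = nat (k (v @ [i]))} = {\<lambda>_. 0 :: nat}"
    (is "?L = _")
  proof (intro equalityI subsetI)
    fix l assume l: "l \<in> ?L"
    have "l e = 0" for e
    proof (cases "e \<in> {v @ [i + j] | j. j < m}")
      case True
      then show ?thesis using l assms(1) by auto
    qed (use l in blast)
    then show "l \<in> {\<lambda>_. 0}" by auto
  qed (simp add: assms(1))
  moreover have "\<not> (k (v @ [i]) < 0 \<or> (\<exists>j<m. k (v @ [i, j]) < 0))"
    using assms(1) assms(2)[THEN leD] by auto
  ultimately show ?thesis unfolding subst_shrink_def by (simp only: if_False) simp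
qed

text \<open>
  On both sides the poles in \<open>z\<close> are bounded. So it suffices to compare them after clearing denominators, and the refinement axiom does
  this: at \<open>y = z\<^sub>1 = 0\<close> both denominators become \<open>x - z\<close>, \<open>x\<close>, \<open>z\<close> and their negatives.
\<close>

lemma iterated_field_eq_three_point:
  "(\<lambda>m n. f2_at_y_zero f a (f2_at_y_zero f b c n) m) = three_point a b c"
proof -
  let ?A = "\<lambda>l::addr. if l = [0] then a else if l = [1, 0] then b else c"
  let ?s = "\<lambda>j. if 1 \<le> j \<and> j < 1 + 2 then {[] @ [1, j - 1], [] @ [1]} else {shrink_addr [] 1 2 ([] @ [j])}"
  let ?S = "{[1], [1, 1 :: nat]}"
  have "refines_shrink comb [] 1 (length [Leaf, Leaf]) (length [Leaf, Leaf, Leaf])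
      (f (replace_at comb [] (Node [Leaf, Leaf, Leaf]))) (f comb)"
    by (rule refinement_shrink[where ts = "[Leaf, flat2]"]) (simp_all add: is_tree_simps)
  moreover have "length [Leaf, Leaf] = 2" "length [Leaf, Leaf, Leaf] = 3"
    "replace_at comb [] flat3 = flat3"
    by simp_all
  ultimately have "refines_shrink comb [] 1 2 3 (f flat3) (f comb)"
    by (simp only:)
  from this[unfolded refines_shrink_def, THEN conjunct2, THEN spec[of _ ?A], THEN spec[of _ "\<lambda>_. 0"]]
  obtain N P where "P = clear_denoms 3 (\<lambda>j. {[] @ [j]}) N (f flat3 (\<lambda>u. ?A (shrink_addr [] 1 2 u)))"
    and raw_neg: "\<forall>n. (\<forall>e. e \<notin> {[] @ [j] | j. j < 3} \<longrightarrow> n e = 0) \<longrightarrow>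
             (\<exists>j<3. n ([] @ [j]) < 0) \<longrightarrow> P n = 0"
    and raw_sub: "\<forall>n. supp n \<subseteq> edges comb \<longrightarrow>
             (\<forall>e. e \<notin> incoming comb [] \<union> incoming comb ([] @ [1]) \<longrightarrow> n e = 0) \<longrightarrow>
             clear_denoms 3 ?s N (f comb ?A) n = subst_shrink [] 1 2 P n"
    by (elim exE conjE) (rule that)
  then have P: "P = clear_denoms 3 (\<lambda>j. {[j]}) N (f flat3 (\<lambda>u. ?A (shrink_addr [] 1 2 u)))"
    by simp
  have neg: "P n = 0" if "\<And>e. e \<notin> {[j] | j. j < 3} \<Longrightarrow> n e = 0" "\<exists>j<3. n [j] < 0" for n
    using raw_neg that unfolding append_Nil by blast
  have sub: "clear_denoms 3 ?s N (f comb ?A) n = subst_shrink [] 1 2 P n"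
    if "supp n \<subseteq> edges comb" for n
  proof (rule raw_sub[rule_format, OF that])
    fix e assume "e \<notin> incoming comb [] \<union> incoming comb ([] @ [1])"
    then show "n e = 0"
      using that unfolding append_Nil incoming_simps edges_simps supp_subset_iff by blast
  qed
  have shrink: "shrink_addr [] 1 2 e = shrink_tail 1 2 e" for e
    by (simp add: shrink_addr_def relocate_def)
  have inputs: "f flat3 (\<lambda>u. ?A (shrink_addr [] 1 2 u)) = f flat3 (inputs3 a b c)"
    by (rule f_cong) (auto simp: is_tree_simps leaves_simps inputs3_def shrink[unfolded One_nat_def])
  have comb: "f comb ?A n = f flat2 (inputs2 a (f flat2 (inputs2 b c) (\<lambda>e. if e = [] then 0 else n (1 # e))))
      (\<lambda>e. if e \<in> {[0], [1]} then n e else 0)" if "supp n \<subseteq> edges comb" for n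
    using f_comb[OF that, of ?A] by simp
  (* ?S consists of y = [1] and of the variable z_1 = [1, 1] of c: the slice of the composite
     restricts to y = z_1 = 0, leaving x = [0] and z = [1, 0]. *)
  have below: "vanishes_below ?S (\<lambda>_. 0) (f comb ?A)"
  proof -
    have "f comb ?A n = 0" if "n [1] < 0 \<or> n [1, 1] < 0" for n
    proof (cases "supp n \<subseteq> edges comb")
      case True
      show ?thesis
      proof (cases "n [1, 1] < 0")
        case inner: True
        have "f flat2 (inputs2 b c) (\<lambda>e. if e = [] then 0 else n (1 # e)) = 0"
          using f2_vanishes_below[of b c] inner unfolding vanishes_below_def by simp
        then show ?thesis unfolding comb[OF True] by (simp add: f2_zero_right)
      next
        case False
        then show ?thesis
          using f2_vanishes_below that unfolding comb[OF True] vanishes_below_def by simp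
      qed
    next
      case False
      then show ?thesis using f_supp[of comb ?A n] by (auto simp: is_tree_simps)
    qed
    then show ?thesis unfolding vanishes_below_def by blast
  qed
  have "slice [0] [1, 0] (\<lambda>_. 0) (f comb ?A) = (\<lambda>m n. f2_at_y_zero f a (f2_at_y_zero f b c n) m)"
  proof (intro ext)
    fix i j :: int
    let ?n = "(\<lambda>_. 0)([0] := i, [1, 0] := j)"
    have supp: "supp ?n \<subseteq> edges comb" by (auto simp: supp_subset_iff edges_simps)
    have exps: "(\<lambda>e. if e = [] then 0 else ?n (1 # e)) = (\<lambda>e. if e = [0] then j else 0)"
      "(\<lambda>e. if e \<in> {[0], [1]} then ?n e else 0) = (\<lambda>e. if e = [0] then i else 0)"
      by (auto simp: fun_eq_iff)
    show "slice [0] [1, 0] (\<lambda>_. 0) (f comb ?A) i j =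
        f2_at_y_zero f a (f2_at_y_zero f b c j) i"
      unfolding slice_def comb[OF supp] exps f2_at_y_zero_eq ..
  qed
  moreover have "slice [0] [1, 0] (\<lambda>_. 0) (clear_denoms 3 ?s N (f comb ?A)) =
      mult_linears N (slice_coeffs [0] [1, 0] 3 ?s) (slice [0] [1, 0] (\<lambda>_. 0) (f comb ?A))"
    by (rule slice_clear_denoms[OF below]) (auto simp: shrink[unfolded One_nat_def] less_Suc_eq numeral_3_eq_3)
  moreover have "slice_coeffs [0] [1, 0] 3 ?s = slice_coeffs [0] [1] 3 (\<lambda>j. {[j]})"
    by (simp add: slice_coeffs_def upt_2_3 shrink[unfolded One_nat_def])
  moreover have "slice [0] [1, 0] (\<lambda>_. 0) (clear_denoms 3 ?s N (f comb ?A)) = slice [0] [1] (\<lambda>_. 0) P"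
  proof (intro ext)
    fix i j :: int
    let ?n = "(\<lambda>_. 0)([0] := i, [1, 0] := j)"
    have "slice [0] [1, 0] (\<lambda>_. 0) (clear_denoms 3 ?s N (f comb ?A)) i j = subst_shrink [] 1 2 P ?n"
      unfolding slice_def by (rule sub) (auto simp: supp_subset_iff edges_simps)
    also have "\<dots> = P ((\<lambda>_. 0)([0] := i, [1] := j))"
    proof (cases "j < 0")
      case True
      then have "subst_shrink [] 1 2 P ?n = 0" unfolding subst_shrink_def by auto
      moreover have "P ((\<lambda>_. 0)([0] := i, [1] := j)) = 0" by (rule neg) (use True in auto)
      ultimately show ?thesis by simp
    next
      case False
      have "(\<lambda>e. ?n (shrink_addr [] 1 2 e)) = (\<lambda>_. 0)([0] := i, [1] := j)"
      proof
        fix e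
        show "?n (shrink_addr [] 1 2 e) = ((\<lambda>_. 0)([0] := i, [1] := j)) e"
          unfolding shrink by (cases e) auto
      qed
      moreover have "subst_shrink [] 1 2 P ?n = P (\<lambda>e. ?n (shrink_addr [] 1 2 e))"
        using False by (intro subst_shrink_at_zero) auto
      ultimately show ?thesis by simp
    qed
    finally show "slice [0] [1, 0] (\<lambda>_. 0) (clear_denoms 3 ?s N (f comb ?A)) i j = slice [0] [1] (\<lambda>_. 0) P i j"
      by (simp add: slice_def)
  qed
  ultimately have "mult_linears N (slice_coeffs [0] [1] 3 (\<lambda>j. {[j]}))
      (\<lambda>m n. f2_at_y_zero f a (f2_at_y_zero f b c n) m) = 
      mult_linears N (slice_coeffs [0] [1] 3 (\<lambda>j. {[j]})) (three_point a b c)"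
    unfolding P inputs slice_flat3 slice_coeffs_flat3 by (simp only:)
  then show ?thesis
  proof (rule mult_linears_cancel[rotated 3])
    obtain d where d: "\<And>n. n < d \<Longrightarrow> f2_at_y_zero f b c n = 0"
      using field_Laurent by blast
    have "f2_at_y_zero f a 0 m = 0" for m
      using f2_zero_right unfolding f2_at_y_zero_eq .
    with d show "bounded_snd (\<lambda>m n. f2_at_y_zero f a (f2_at_y_zero f b c n) m)"
      by (intro bounded_sndI[of d]) simp
    show "bounded_snd (three_point a b c)" by (rule bounded_three_point)
    show "(0, 0) \<notin> set (slice_coeffs [0] [1] 3 (\<lambda>j. {[j]}))"
      unfolding slice_coeffs_flat3 by simp
  qed
qed

text \<open>
  Write \<open>A\<close> and \<open>B\<close> for the two expansions of the three-point function, and \<open>D = (x - z)\<^sup>N x\<^sup>M z\<^sup>M\<close> with \<open>N\<close>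
  independent of \<open>c\<close>. Then \<open>D A\<close> is a power series. In particular its poles in \<open>x\<close> are bounded, as are those of
  \<open>D B\<close>. As \<open>A\<close> and \<open>B\<close> have the same numerator, cancellation in the space of distributions bounded in \<open>x\<close> yields
  \<open>D A = D B\<close>, and the monomial \<open>x\<^sup>M z\<^sup>M\<close> can be removed.
\<close>

lemma locality:
  "\<exists>N. \<forall>c. (mult_x_minus_y ^^ N) (\<lambda>m n. f2_at_y_zero f a (f2_at_y_zero f b c n) m -
      f2_at_y_zero f b (f2_at_y_zero f a c m) n) = (\<lambda>m n. 0)"
proof -
  obtain N where N: "\<And>c. \<exists>M. \<forall>i j. i < 0 \<or> j < 0 \<longrightarrow> (mult_linear 0 1 ^^ M) ((mult_linear 1 0 ^^ M)
      ((mult_linear 1 (-1) ^^ N) (three_point a b c))) i j = 0"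
    using three_point_pole_uniform by blast
  have "(mult_x_minus_y ^^ N) (three_point a b c) = (mult_x_minus_y ^^ N) (swap (three_point b a c))" for c
  proof -
    let ?A = "three_point a b c" and ?B = "swap (three_point b a c)"
    obtain M where M: "\<And>i j. i < 0 \<or> j < 0 \<Longrightarrow> (mult_linear 0 1 ^^ M) ((mult_linear 1 0 ^^ M)
        ((mult_linear 1 (-1) ^^ N) ?A)) i j = 0"
      using N by blast
    define D where "D F = (mult_linear 0 1 ^^ M) ((mult_linear 1 0 ^^ M)
        ((mult_linear 1 (-1) ^^ N) F))" for F
    obtain K cs where K: "mult_linears K cs ?A = mult_linears K cs ?B" and cs: "(0, 0) \<notin> set cs"
      using three_point_symmetric[of a b c] by fastforce
    (* A is bounded in z and B in x, so A = B does not follow from the equality K of numerators. *)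
    have "mult_linears K cs (D ?A) = mult_linears K cs (D ?B)"
      unfolding D_def mult_linears_commute K ..
    then have "mult_linears K (map prod.swap cs) (swap (D ?A)) = mult_linears K (map prod.swap cs) (swap (D ?B))"
      unfolding swap_mult_linears[symmetric] by simp
    then have "swap (D ?A) = swap (D ?B)"
    proof (rule mult_linears_cancel[rotated 3])
      show "bounded_snd (swap (D ?A))"
        by (rule bounded_sndI[of 0]) (simp add: swap_def D_def M)
      have "swap ?B = three_point b a c" by (simp add: swap_def)
      then show "bounded_snd (swap (D ?B))"
        unfolding D_def swap_mult_linear_funpow
        by (simp only:) (intro bounded_snd_mult_linear_funpow bounded_three_point)
      show "(0, 0) \<notin> set (map prod.swap cs)" using cs by auto
    qed
    then have "D ?A = D ?B" by (simp add: swap_def fun_eq_iff)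
    then show ?thesis
      unfolding D_def mult_linear_difference by (rule mult_x_funpow_cancel[OF mult_z_funpow_cancel])
  qed
  moreover have "(\<lambda>m n. f2_at_y_zero f a (f2_at_y_zero f b c n) m -
      f2_at_y_zero f b (f2_at_y_zero f a c m) n) =
      (\<lambda>m n. three_point a b c m n - swap (three_point b a c) m n)" for c
    unfolding iterated_field_eq_three_point[symmetric] swap_def ..
  ultimately show ?thesis
    by (intro exI[of _ N] allI) (simp only: mult_x_minus_y_funpow_diff diff_self)
qed

end

section \<open>The vertex algebra\<close>

theorem theorem5p4:
  fixes scale :: "complex \<Rightarrow> 'b::ab_group_add \<Rightarrow> 'b"
    and T :: "'b \<Rightarrow> 'b"
    and f :: "ptree \<Rightarrow> 'b mmap"
  assumes "commutative_relaxed_algebra scale T f"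
  shows "\<exists>Y :: 'b \<Rightarrow> 'b \<Rightarrow> 'b fls.
    (\<forall>a b n. fls_nth (Y a b) n = f2_at_y_zero f a b n) \<and>
    vertex_algebra scale T (vacuum_vector f) Y"
proof -
  interpret commutative_relaxed_algebra scale T f by (rule assms)
  define Y where "Y a b = Abs_fls (f2_at_y_zero f a b)" for a b
  have Y: "fls_nth (Y a b) n = f2_at_y_zero f a b n" for a b n
    unfolding Y_def using field_Laurent[of a b] by (intro nth_Abs_fls_ex_lower_bound) auto
  have "vertex_algebra scale T (vacuum_vector f) Y"
  proof (intro vertex_algebra.intro vertex_algebra_axioms.intro)
    show "G_module scale T" by (rule G_module_axioms)
  next
    fix a b n
    show "Vector_Spaces.linear scale scale (\<lambda>a. fls_nth (Y a b) n)"
      unfolding Y by (rule field_linear_left)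
    show "Vector_Spaces.linear scale scale (\<lambda>b. fls_nth (Y a b) n)"
      unfolding Y by (rule field_linear_right)
    show "T (vacuum_vector f) = 0" by (rule T_vacuum)
    show "Y (vacuum_vector f) a = fls_const a"
      by (intro fls_eqI) (simp add: Y field_of_vacuum)
    show "fls_nth (Y a (vacuum_vector f)) n = 0" if "n < 0"
      using that by (simp add: Y field_at_vacuum f_flat1_negative)
    show "fls_nth (Y a (vacuum_vector f)) 0 = a"
      by (simp add: Y field_at_vacuum f_flat1_const del: fun_upd_triv)
    show "T (fls_nth (Y a b) n) - fls_nth (Y a (T b)) n =
        scale (of_int (n + 1)) (fls_nth (Y a b) (n + 1))"
      unfolding Y by (rule field_translation)
    show "\<exists>N. \<forall>c. (mult_x_minus_y ^^ N)
        (\<lambda>m n. fls_nth (Y a (fls_nth (Y b c) n)) m - fls_nth (Y b (fls_nth (Y a c) m)) n)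
        = (\<lambda>m n. 0)"
      unfolding Y by (rule locality)
  qed
  with Y show ?thesis by blast
qed

end
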